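(* Let $H\in\mathbb{C}(t)[q,p]$ and consider the polynomial Hamiltonian system $\frac{dq}{dt}=\frac{\partial H}{\partial p}$, $\frac{dp}{dt}=-\frac{\partial H}{\partial q}$. Assume: (C1) $\deg(H)=15$ with respect to $q,p$; (C2) the system becomes again a polynomial Hamiltonian system in each of the coordinates $$\begin{aligned} r_0&: x_0=1/q,\ y_0=-(qp+\alpha_0)q,\\ r_1&: x_1=-(pq-\alpha_1)p,\ y_1=1/p,\\ r_2&: x_2=-(pq-(\alpha_1+\alpha_2))p,\ y_2=1/p,\\ r_3&: x_3=-(pq-(\alpha_1+\alpha_2+\alpha_3))p,\ y_3=1/p,\\ r_4&: x_4=-(pq-(\alpha_1+\alpha_2+\alpha_3+\alpha_4))p,\ y_4=1/p,\\ r_5&: x_5=-(pq-(\alpha_1+\alpha_2+\alpha_3+\alpha_4+\alpha_5))p,\ y_5=1/p,\\ r_6&: x_6=-(p(q-1)-\alpha_6)p,\ y_6=1/p,\\ r_7&: x_7=-(p(q-1)-(\alpha_6+\alpha_7))p,\ y_7=1/p; \end{aligned}$$ (C3) in addition to (C2), the Hamiltonian system in the coordinates $(x_0,y_0)$ of $r_0$ becomes again a polynomial Hamiltonian system in the coordinates $r_8: x_8=-(x_0y_0-\alpha_8)y_0,\ y_8=1/y_0$. Then such a system coincides with the system $\frac{dq}{dt}=\frac{\partial I}{\partial p}$, $\frac{dp}{dt}=-\frac{\partial I}{\partial q}$, where $I$ is the polynomial $$\begin{aligned} I={}&q^5(q-1)^4p^6+q^4(q-1)^3(3\kappa q+\beta_1)p^5+q^3(q-1)^2\{3(\kappa^2+\varepsilon)q^2+mq+\beta_2\}p^4\\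 &+q^2(q-1)\{A_3q^3+xq^2-(A_3+x+\beta_3+2\gamma_1\gamma_2)q+\beta_3\}p^3\\ &+q\{A_2q^4+B_2q^3+C_2q^2+(\gamma_2^2-A_2-B_2-C_2-\beta_4)q+\beta_4\}p^2\\ &+\{3\kappa\varepsilon^2q^4+B_1q^3+C_1q^2+G_1q-\beta_5\}p+\varepsilon^3q^3+\varepsilon^2b_0q^2+\varepsilon c_0q \end{aligned}$$ with the constants defined in the context. Here the constant parameters $\alpha_i$ satisfy the relation $6\alpha_0+5\alpha_1+4\alpha_2+3\alpha_3+2\alpha_4+\alpha_5+4\alpha_6+2\alpha_7+3\alpha_8=0$.
   Context: A Hamiltonian system in $(q,p)$ "becomes again a polynomial Hamiltonian system" in coordinates $(x,y)$, where $(q,p)\mapsto(x,y)$ is a birational symplectic change of variables ($dx\wedge dy=dq\wedge dp$), if in the new variables it takes the form $\frac{dx}{dt}=\frac{\partial K}{\partial y}$, $\frac{dy}{dt}=-\frac{\partial K}{\partial x}$ for some $K\in\mathbb{C}(t)[x,y]$. The $\alpha_0,\dots,\alpha_8$ are constant complex parameters. Constants in $I$: $\kappa=2\alpha_0+\alpha_8$, $\varepsilon=\alpha_0(\alpha_0+\alpha_8)$, $\gamma_1=2\alpha_6+\alpha_7$, $\gamma_2=\alpha_6(\alpha_6+\alpha_7)$; $\beta_1,\dots,\beta_5$ are the elementary symmetric functions (of degree $1,\dots,5$) of the five numbers $\rho_k=\alpha_1+\cdots+\alpha_k$, $k=1,\dots,5$; and $$\begin{aligned} v&=\gamma_1^2+2\gamma_2-\beta_2,\qquad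 m=v-3(\kappa^2+\varepsilon),\qquad b_0=v+4\kappa\gamma_1+3\kappa^2-\varepsilon,\\ A_3&=\kappa^3+6\kappa\varepsilon,\qquad x=2\kappa v+3\kappa^3-12\kappa\varepsilon+6\kappa^2\gamma_1-4\varepsilon\gamma_1,\\ k_0&=\gamma_1^3+5\kappa\gamma_1^2+\kappa\gamma_2+9\kappa^2\gamma_1-\varepsilon\gamma_1+5\kappa^3-(\gamma_1+2\kappa)\beta_2-\beta_3,\\ A_2&=3\kappa^2\varepsilon+3\varepsilon^2,\\ B_2&=(\kappa^2+2\varepsilon)v+4\kappa^3\gamma_1+4\kappa\varepsilon\gamma_1+3\kappa^4-3\kappa^2\varepsilon-6\varepsilon^2,\\ C_2&=\beta_4-3A_2-2B_2+\gamma_2(\gamma_1^2+\gamma_2+3\kappa\gamma_1+3\kappa^2+3\varepsilon-\beta_2)-\gamma_1k_0,\\ c_2&=-2\gamma_1^2-4\gamma_2+3\beta_2-3\kappa^2+3\varepsilon-6\kappa\gamma_1,\\ c_1&=-2\gamma_1\gamma_2-4\kappa^3+3\kappa\varepsilon-2\kappa\gamma_1^2-4\kappa\gamma_2+\kappa\beta_2-6\kappa^2\gamma_1+2\varepsilon\gamma_1-\beta_3,\\ c_0&=C_2-\kappa c_1-\varepsilon c_2,\\ B_1&=2\kappa\varepsilon b_0-2\varepsilon^2(2\kappa+\gamma_1),\qquad C_1=\kappa c_0+\varepsilon c_1,\\ G_1&=\gamma_2k_0+\beta_5-3\kappa\varepsilon^2-B_1-C_1 . \end{aligned}$$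
   Formalization: The claim fails for H=2I and when charts coincide (all α_i=0, H=I+q(q-1)p²). Proved: if α_7≠0 and at least four of ρ_1,…,ρ_5 are distinct, the system is c times the system of I, where c≠0 in C(t) is the coefficient of q^9p^6 in H. *)

theory Defs
  imports "HOL-Computational_Algebra.Computational_Algebra"
begin

section \<open>Polynomials and rational functions in two variables\<close>

text \<open>
  A polynomial \<open>H \<in> k[q,p]\<close> is a nested polynomial of type \<open>'k poly poly\<close>: the outer
  variable is \<open>p\<close> and the inner one is \<open>q\<close>, so that \<open>coeff (coeff H j) i\<close> is the
  coefficient of \<open>q\<^sup>i p\<^sup>j\<close>.  The field \<open>k(q,p)\<close> is \<open>'k poly poly fract\<close>.  The same types
  serve for the new variables, with \<open>x\<close> in the role of \<open>q\<close> and \<open>y\<close> in the role of \<open>p\<close>.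
\<close>

type_synonym Ct = "complex poly fract"

definition const :: "complex \<Rightarrow> Ct poly poly" where
  "const a = [:[:to_fract [:a:]:]:]"

definition q_var :: "'k::field poly poly" where
  "q_var = [:[:0, 1:]:]"

definition p_var :: "'k::field poly poly" where
  "p_var = [:0, 1:]"

definition total_degree :: "'k::field poly poly \<Rightarrow> nat" where
  "total_degree H = Max (insert 0 {i + j |i j. coeff (coeff H j) i \<noteq> 0})"

definition dq :: "'k::field poly poly \<Rightarrow> 'k poly poly" where
  "dq H = map_poly pderiv H"

definition dp :: "'k::field poly poly \<Rightarrow> 'k poly poly" where
  "dp H = pderiv H"

lemma dq_add: "dq (f + g) = dq f + dq g"
  by (rule poly_eqI) (simp add: dq_def coeff_map_poly pderiv_add)

lemma dq_mult: "dq (f * g) = dq f * g + f * dq g"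
proof (induction f)
  case 0
  show ?case by (simp add: dq_def)
next
  case (pCons a f)
  have dq_pCons: "dq (pCons b h) = pCons (pderiv b) (dq h)" for b and h :: "'a poly poly"
    by (rule poly_eqI) (simp add: dq_def coeff_map_poly coeff_pCons split: nat.split)
  have dq_smult: "dq (smult b h) = smult (pderiv b) h + smult b (dq h)" for b and h :: "'a poly poly"
    by (rule poly_eqI) (simp add: dq_def coeff_map_poly pderiv_mult algebra_simps)
  show ?case
    by (simp add: pCons.IH dq_pCons dq_smult dq_add algebra_simps)
qed

lemma dp_mult: "dp (f * g) = dp f * g + f * dp g"
  by (simp add: dp_def pderiv_mult algebra_simps)

text \<open>
  The extension of a derivation \<open>d\<close> of an integral domain to its field of fractions; by
  \<open>fract_derivation_Fract\<close> below, the value does not depend on the chosen representative.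
\<close>

definition fract_derivation :: "('a::idom \<Rightarrow> 'a) \<Rightarrow> 'a fract \<Rightarrow> 'a fract" where
  "fract_derivation d F =
     (THE D. \<forall>a b. b \<noteq> 0 \<and> F = Fract a b \<longrightarrow> D = Fract (d a * b - a * d b) (b * b))"

lemma fract_derivation_Fract:
  fixes d :: "'a::idom \<Rightarrow> 'a"
  assumes d: "\<And>f g. d (f * g) = d f * g + f * d g" and b: "b \<noteq> 0"
  shows "fract_derivation d (Fract a b) = Fract (d a * b - a * d b) (b * b)"
  unfolding fract_derivation_def
proof (rule the_equality)
  show "\<forall>a' b'. b' \<noteq> 0 \<and> Fract a b = Fract a' b' \<longrightarrow>
      Fract (d a * b - a * d b) (b * b) = Fract (d a' * b' - a' * d b') (b' * b')"
  proof (intro allI impI)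
    fix a' b' assume "b' \<noteq> 0 \<and> Fract a b = Fract a' b'"
    then have b': "b' \<noteq> 0" and e: "a * b' = a' * b"
      using b by (auto simp: eq_fract)
    have "d a * b' + a * d b' = d a' * b + a' * d b"
      using arg_cong[OF e, of d] by (simp add: d)
    with e have "(d a * b - a * d b) * (b' * b') = (d a' * b' - a' * d b') * (b * b)"
      by algebra
    then show "Fract (d a * b - a * d b) (b * b) = Fract (d a' * b' - a' * d b') (b' * b')"
      using b b' by (simp add: eq_fract)
  qed
qed (use b in blast)

definition dq_rat :: "'k::field poly poly fract \<Rightarrow> 'k poly poly fract" where
  "dq_rat = fract_derivation dq"

definition dp_rat :: "'k::field poly poly fract \<Rightarrow> 'k poly poly fract" where
  "dp_rat = fract_derivation dp"

lemma dq_rat_Fract: "b \<noteq> 0 \<Longrightarrow> dq_rat (Fract a b) = Fract (dq a * b - a * dq b) (b * b)"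
  unfolding dq_rat_def by (rule fract_derivation_Fract[OF dq_mult])

lemma dp_rat_Fract: "b \<noteq> 0 \<Longrightarrow> dp_rat (Fract a b) = Fract (dp a * b - a * dp b) (b * b)"
  unfolding dp_rat_def by (rule fract_derivation_Fract[OF dp_mult])

text \<open>\<open>subst2 K X Y\<close> is the value \<open>K(X, Y)\<close>.\<close>

definition subst2 ::
  "'k::field poly poly \<Rightarrow> 'k poly poly fract \<Rightarrow> 'k poly poly fract \<Rightarrow> 'k poly poly fract" where
  "subst2 K X Y =
     poly (map_poly (\<lambda>f. poly (map_poly (\<lambda>c. to_fract [:[:c:]:]) f) X) K) Y"


section \<open>Hamiltonian systems and changes of coordinates\<close>

text \<open>
  The derivative of a function \<open>F \<in> k(q,p)\<close> along the system
  \<open>dq/dt = \<partial>H/\<partial>p\<close>, \<open>dp/dt = - \<partial>H/\<partial>q\<close>.  The term \<open>\<partial>F/\<partial>t\<close> is absent because the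
  coordinate functions below do not depend on \<open>t\<close>.
\<close>

definition time_deriv :: "'k::field poly poly \<Rightarrow> 'k poly poly fract \<Rightarrow> 'k poly poly fract" where
  "time_deriv H F = dq_rat F * to_fract (dp H) - dp_rat F * to_fract (dq H)"

definition hamiltonian_form ::
  "'k::field poly poly \<Rightarrow> 'k poly poly fract \<times> 'k poly poly fract \<Rightarrow> 'k poly poly \<Rightarrow> bool" where
  "hamiltonian_form H = (\<lambda>(X, Y) K.
     time_deriv H X = subst2 (dp K) X Y \<and>
     time_deriv H Y = - subst2 (dq K) X Y)"

definition becomes_polynomial_hamiltonian ::
  "'k::field poly poly \<Rightarrow> 'k poly poly fract \<times> 'k poly poly fract \<Rightarrow> bool" where
  "becomes_polynomial_hamiltonian H XY \<longleftrightarrow> (\<exists>K. hamiltonian_form H XY K)"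

definition rho :: "(nat \<Rightarrow> complex) \<Rightarrow> nat \<Rightarrow> complex" where
  "rho \<alpha> k = (\<Sum>i=1..k. \<alpha> i)"

text \<open>
  The coordinates \<open>r\<^sub>0, \<dots>, r\<^sub>8\<close>.  Those of \<open>r\<^sub>8\<close> are functions of the coordinates
  \<open>(x\<^sub>0, y\<^sub>0)\<close> of \<open>r\<^sub>0\<close>, for which the variables \<open>q, p\<close> stand in that case.
  All of them satisfy \<open>dx \<and> dy = dq \<and> dp\<close>.
\<close>

definition coords :: "(nat \<Rightarrow> complex) \<Rightarrow> nat \<Rightarrow> Ct poly poly fract \<times> Ct poly poly fract" where
  "coords \<alpha> i =
     (let q = to_fract q_var; p = to_fract p_var; c = (\<lambda>a. to_fract (const a)) in
      if i = 0 then (1 / q, - (q * p + c (\<alpha> 0)) * q)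
      else if i \<le> 5 then (- (p * q - c (rho \<alpha> i)) * p, 1 / p)
      else if i = 6 then (- (p * (q - 1) - c (\<alpha> 6)) * p, 1 / p)
      else if i = 7 then (- (p * (q - 1) - c (\<alpha> 6 + \<alpha> 7)) * p, 1 / p)
      else (- (q * p - c (\<alpha> 8)) * p, 1 / p))"


section \<open>The polynomial \<open>I\<close>\<close>

context
  fixes \<alpha> :: "nat \<Rightarrow> complex"
begin

qualified definition "\<kappa> = 2 * \<alpha> 0 + \<alpha> 8"
qualified definition "\<epsilon> = \<alpha> 0 * (\<alpha> 0 + \<alpha> 8)"
qualified definition "\<gamma>\<^sub>1 = 2 * \<alpha> 6 + \<alpha> 7"
qualified definition "\<gamma>\<^sub>2 = \<alpha> 6 * (\<alpha> 6 + \<alpha> 7)"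

qualified definition \<beta> :: "nat \<Rightarrow> complex" where
  "\<beta> j = (\<Sum>S | S \<subseteq> {1..5} \<and> card S = j. \<Prod>k\<in>S. rho \<alpha> k)"

qualified definition "v = \<gamma>\<^sub>1^2 + 2 * \<gamma>\<^sub>2 - \<beta> 2"
qualified definition "m = v - 3 * (\<kappa>^2 + \<epsilon>)"
qualified definition "b\<^sub>0 = v + 4 * \<kappa> * \<gamma>\<^sub>1 + 3 * \<kappa>^2 - \<epsilon>"
qualified definition "A\<^sub>3 = \<kappa>^3 + 6 * \<kappa> * \<epsilon>"
qualified definition "x = 2 * \<kappa> * v + 3 * \<kappa>^3 - 12 * \<kappa> * \<epsilon> + 6 * \<kappa>^2 * \<gamma>\<^sub>1 - 4 * \<epsilon> * \<gamma>\<^sub>1"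
qualified definition "k\<^sub>0 = \<gamma>\<^sub>1^3 + 5 * \<kappa> * \<gamma>\<^sub>1^2 + \<kappa> * \<gamma>\<^sub>2 + 9 * \<kappa>^2 * \<gamma>\<^sub>1 - \<epsilon> * \<gamma>\<^sub>1 + 5 * \<kappa>^3
  - (\<gamma>\<^sub>1 + 2 * \<kappa>) * \<beta> 2 - \<beta> 3"
qualified definition "A\<^sub>2 = 3 * \<kappa>^2 * \<epsilon> + 3 * \<epsilon>^2"
qualified definition "B\<^sub>2 = (\<kappa>^2 + 2 * \<epsilon>) * v + 4 * \<kappa>^3 * \<gamma>\<^sub>1 + 4 * \<kappa> * \<epsilon> * \<gamma>\<^sub>1 + 3 * \<kappa>^4
  - 3 * \<kappa>^2 * \<epsilon> - 6 * \<epsilon>^2"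
qualified definition "C\<^sub>2 = \<beta> 4 - 3 * A\<^sub>2 - 2 * B\<^sub>2
  + \<gamma>\<^sub>2 * (\<gamma>\<^sub>1^2 + \<gamma>\<^sub>2 + 3 * \<kappa> * \<gamma>\<^sub>1 + 3 * \<kappa>^2 + 3 * \<epsilon> - \<beta> 2) - \<gamma>\<^sub>1 * k\<^sub>0"
qualified definition "c\<^sub>2 = - 2 * \<gamma>\<^sub>1^2 - 4 * \<gamma>\<^sub>2 + 3 * \<beta> 2 - 3 * \<kappa>^2 + 3 * \<epsilon> - 6 * \<kappa> * \<gamma>\<^sub>1"
qualified definition "c\<^sub>1 = - 2 * \<gamma>\<^sub>1 * \<gamma>\<^sub>2 - 4 * \<kappa>^3 + 3 * \<kappa> * \<epsilon> - 2 * \<kappa> * \<gamma>\<^sub>1^2 - 4 * \<kappa> * \<gamma>\<^sub>2 + \<kappa> * \<beta> 2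
  - 6 * \<kappa>^2 * \<gamma>\<^sub>1 + 2 * \<epsilon> * \<gamma>\<^sub>1 - \<beta> 3"
qualified definition "c\<^sub>0 = C\<^sub>2 - \<kappa> * c\<^sub>1 - \<epsilon> * c\<^sub>2"
qualified definition "B\<^sub>1 = 2 * \<kappa> * \<epsilon> * b\<^sub>0 - 2 * \<epsilon>^2 * (2 * \<kappa> + \<gamma>\<^sub>1)"
qualified definition "C\<^sub>1 = \<kappa> * c\<^sub>0 + \<epsilon> * c\<^sub>1"
qualified definition "G\<^sub>1 = \<gamma>\<^sub>2 * k\<^sub>0 + \<beta> 5 - 3 * \<kappa> * \<epsilon>^2 - B\<^sub>1 - C\<^sub>1"

definition I_poly :: "Ct poly poly" where
  "I_poly = (let q = q_var; p = p_var; c = const in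
     q^5 * (q - 1)^4 * p^6
   + q^4 * (q - 1)^3 * (c (3 * \<kappa>) * q + c (\<beta> 1)) * p^5
   + q^3 * (q - 1)^2 * (c (3 * (\<kappa>^2 + \<epsilon>)) * q^2 + c m * q + c (\<beta> 2)) * p^4
   + q^2 * (q - 1) * (c A\<^sub>3 * q^3 + c x * q^2
       - c (A\<^sub>3 + x + \<beta> 3 + 2 * \<gamma>\<^sub>1 * \<gamma>\<^sub>2) * q + c (\<beta> 3)) * p^3
   + q * (c A\<^sub>2 * q^4 + c B\<^sub>2 * q^3 + c C\<^sub>2 * q^2
       + c (\<gamma>\<^sub>2^2 - A\<^sub>2 - B\<^sub>2 - C\<^sub>2 - \<beta> 4) * q + c (\<beta> 4)) * p^2
   + (c (3 * \<kappa> * \<epsilon>^2) * q^4 + c B\<^sub>1 * q^3 + c C\<^sub>1 * q^2 + c G\<^sub>1 * q - c (\<beta> 5)) * p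
   + c (\<epsilon>^3) * q^3 + c (\<epsilon>^2 * b\<^sub>0) * q^2 + c (\<epsilon> * c\<^sub>0) * q)"

end

end

theory Submission
  imports Defs
begin

text \<open>
  A change of coordinates with \<open>dx \<and> dy = dq \<and> dp\<close> turns the system of \<open>H\<close> into the system of
  \<open>K\<close> if and only if \<open>H - K(x, y)\<close> is a constant.  Collecting the monomials of \<open>H\<close> by the weight
  \<open>n = deg p - deg q\<close> gives \<open>H = \<Sum> p\<^sup>n f\<^sub>n(qp) + \<Sum> q\<^sup>n e\<^sub>n(qp)\<close>, and regularity in the charts becomes
  divisibility: \<open>(z - \<rho>\<^sub>k)\<^sup>n\<close> divides \<open>f\<^sub>n\<close>, \<open>(z\<^sup>2 + \<kappa> z + \<epsilon>)\<^sup>n\<close> divides \<open>e\<^sub>n\<close>, and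
  \<open>(w\<^sup>2 - \<gamma>\<^sub>1 w + \<gamma>\<^sub>2)\<^sup>n\<close> divides the corresponding polynomials at \<open>q = 1\<close>.  Degree 15 kills all but
  finitely many weights, and the remaining linear equations are triangular in the degree in \<open>p\<close>:
  they determine the coefficients one after the other from that of \<open>q\<^sup>9 p\<^sup>6\<close>.
\<close>

text \<open>Gives \<open>Ct\<close> and the function fields characteristic 0: comparing degrees
  below cancels natural number factors, and the linear systems are solved over a
  \<open>field_char_0\<close>.\<close>

instance fract :: ("{idom, ring_char_0}") field_char_0
proof
  have "of_nat n = (to_fract (of_nat n) :: 'a fract)" for n
    by (induction n) simp_all
  then show "inj (of_nat :: nat \<Rightarrow> 'a fract)"
    by (simp add: inj_on_def)
qed

section \<open>Derivations of fields of fractions\<close>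

text \<open>The quotient field rules are derived once from additivity and the Leibniz rule, then
  specialised to both \<open>dq_rat\<close> and \<open>dp_rat\<close>.\<close>

locale idom_derivation =
  fixes d :: "'a::idom \<Rightarrow> 'a"
  assumes add: "d (f + g) = d f + d g"
    and mult: "d (f * g) = d f * g + f * d g"
begin

abbreviation D :: "'a fract \<Rightarrow> 'a fract" where
  "D \<equiv> fract_derivation d"

lemma zero: "d 0 = 0"
  using add[of 0 0] by (metis add_0 add_cancel_right_right)

lemma one: "d 1 = 0"
  using mult[of 1 1] by (metis add_cancel_right_right mult.left_neutral mult.right_neutral)

lemma D_Fract: "b \<noteq> 0 \<Longrightarrow> D (Fract a b) = Fract (d a * b - a * d b) (b * b)"
  by (rule fract_derivation_Fract[OF mult])

lemma D_to_fract: "D (to_fract f) = to_fract (d f)"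
  unfolding to_fract_def by (subst D_Fract) (simp_all add: one)

lemma D_add: "D (F + G) = D F + D G"
proof (cases F; cases G)
  fix a b a' b'
  assume "F = Fract a b" "b \<noteq> 0" "G = Fract a' b'" "b' \<noteq> 0"
  then show ?thesis
    by (simp add: D_Fract eq_fract add mult algebra_simps)
qed

lemma D_mult: "D (F * G) = D F * G + F * D G"
proof (cases F; cases G)
  fix a b a' b'
  assume "F = Fract a b" "b \<noteq> 0" "G = Fract a' b'" "b' \<noteq> 0"
  then show ?thesis
    by (simp add: D_Fract eq_fract mult algebra_simps)
qed

lemma D_uminus: "D (- F) = - D F"
proof -
  have "D 0 = 0"
    using D_to_fract[of 0] zero by simp
  then show ?thesis
    using D_add[of F "- F"] by (simp add: eq_neg_iff_add_eq_0 add.commute)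
qed

lemma D_diff: "D (F - G) = D F - D G"
  using D_add[of F "- G"] D_uminus[of G] by simp

lemma D_inverse:
  assumes "F \<noteq> 0"
  shows "D (1 / F) = - D F / F\<^sup>2"
proof -
  have "D (F * (1 / F)) = 0"
    using assms D_to_fract[of 1] one by simp
  then have "D F * (1 / F) + F * D (1 / F) = 0"
    by (simp only: D_mult)
  with assms show ?thesis
    by (simp add: field_simps power2_eq_square add_eq_0_iff)
qed

end

lemma dq_derivation: "idom_derivation dq"
  by standard (simp_all add: dq_add dq_mult)

lemma dp_derivation: "idom_derivation dp"
  by standard (simp add: dp_def pderiv_add, simp add: dp_mult)

interpretation dq: idom_derivation "dq :: 'k::field poly poly \<Rightarrow> 'k poly poly"
  rewrites "fract_derivation dq = (dq_rat :: 'k poly poly fract \<Rightarrow> 'k poly poly fract)"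
  using dq_derivation by (simp_all add: dq_rat_def)

interpretation dp: idom_derivation "dp :: 'k::field poly poly \<Rightarrow> 'k poly poly"
  rewrites "fract_derivation dp = (dp_rat :: 'k poly poly fract \<Rightarrow> 'k poly poly fract)"
  using dp_derivation by (simp_all add: dp_rat_def)

section \<open>Constants and substitution of rational functions\<close>

definition cst :: "'k::field \<Rightarrow> 'k poly poly fract" where
  "cst c = to_fract [:[:c:]:]"

lemma cst_0 [simp]: "cst 0 = 0"
  by (simp add: cst_def)

lemma cst_add: "cst (a + b) = cst a + cst b"
  by (simp add: cst_def flip: to_fract_add)

lemma dq_const [simp]: "dq [:[:c:]:] = 0"
  by (simp add: dq_def map_poly_pCons)

lemma dp_const [simp]: "dp [:f:] = 0"
  by (simp add: dp_def pderiv_pCons)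

lemma dq_rat_cst [simp]: "dq_rat (cst c) = 0"
  unfolding cst_def by (subst dq.D_to_fract) simp

lemma dp_rat_cst [simp]: "dp_rat (cst c) = 0"
  unfolding cst_def by (subst dp.D_to_fract) simp

lemma map_poly_add_hom:
  assumes "\<And>a b. h (a + b) = h a + h b" "h 0 = 0"
  shows "map_poly h (p + q) = map_poly h p + map_poly h q"
  by (rule poly_eqI) (simp add: coeff_map_poly assms)

text \<open>The inner level of \<open>subst2\<close>; separating it allows one induction for the
  inner variable and one for the outer.\<close>

definition subst1 :: "'k::field poly \<Rightarrow> 'k poly poly fract \<Rightarrow> 'k poly poly fract" where
  "subst1 f X = poly (map_poly cst f) X"

lemma subst1_0 [simp]: "subst1 0 X = 0"
  by (simp add: subst1_def)

lemma subst1_add: "subst1 (f + g) X = subst1 f X + subst1 g X"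
  by (simp add: subst1_def map_poly_add_hom cst_add)

lemma subst1_pCons: "subst1 (pCons a f) X = cst a + X * subst1 f X"
  by (simp add: subst1_def map_poly_pCons)

lemma subst2_subst1: "subst2 K X Y = poly (map_poly (\<lambda>f. subst1 f X) K) Y"
  unfolding subst2_def subst1_def cst_def ..

lemma subst2_0 [simp]: "subst2 0 X Y = 0"
  by (simp add: subst2_subst1)

lemma subst2_add: "subst2 (K + L) X Y = subst2 K X Y + subst2 L X Y"
  by (simp add: subst2_subst1 map_poly_add_hom subst1_add)

lemma subst2_pCons: "subst2 (pCons f K) X Y = subst1 f X + Y * subst2 K X Y"
  by (simp add: subst2_subst1 map_poly_pCons)

lemma dq_pCons: "dq (pCons f K) = pCons (pderiv f) (dq K)"
  by (simp add: dq_def map_poly_pCons)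

lemma dp_pCons: "dp (pCons f K) = K + pCons 0 (dp K)"
  by (simp add: dp_def pderiv_pCons)

text \<open>Both sides obey the same recursion under \<open>pCons\<close>, first in the inner
  variable and then in the outer one. An arbitrary \<open>D\<close> that kills constants covers both
  partial derivatives at once.\<close>

lemma chain_rule:
  fixes D :: "'k::field poly poly fract \<Rightarrow> 'k poly poly fract"
  assumes add: "\<And>F G. D (F + G) = D F + D G"
    and mult: "\<And>F G. D (F * G) = D F * G + F * D G"
    and cst: "\<And>c. D (cst c) = 0"
  shows "D (subst2 K X Y) = subst2 (dq K) X Y * D X + subst2 (dp K) X Y * D Y"
proof -
  have zero: "D 0 = 0"
    using cst[of 0] by simp
  have subst1: "D (subst1 f X) = subst1 (pderiv f) X * D X" for f
  proof (induction f)
    case (pCons a f)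
    then show ?case
      by (simp add: subst1_pCons pderiv_pCons subst1_add add mult cst algebra_simps)
  qed (simp add: zero)
  show ?thesis
  proof (induction K)
    case 0
    show ?case by (simp add: zero dq_def dp_def)
  next
    case (pCons f K)
    then show ?case
      by (simp add: subst2_pCons dq_pCons dp_pCons subst2_add add mult subst1 algebra_simps)
  qed
qed

section \<open>Rational functions with vanishing derivatives\<close>

text \<open>The operator z d/dz multiplies the coefficient of z^k by k. After multiplying
  \<open>W\<close> by the variable, the coefficients at \<open>degree f + degree g\<close> differ
  only by the factors \<open>degree f\<close> and \<open>degree g\<close>, which characteristic 0
  tells apart.\<close>

lemma wronskian_zero_degree_eq:
  fixes f g :: "'a::{idom, ring_char_0} poly"
  assumes W: "pderiv f * g = f * pderiv g" and nz: "f \<noteq> 0" "g \<noteq> 0"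
  shows "degree f = degree g"
proof -
  have "pCons 0 (pderiv f) * g = f * pCons 0 (pderiv g)"
    using W by simp
  moreover have "coeff (pCons 0 (pderiv u) * w) (degree u + degree w)
      = of_nat (degree u) * lead_coeff u * lead_coeff w" for u w :: "'a poly"
  proof (cases "degree u = 0")
    case True
    then have "pderiv u = 0" by (simp add: pderiv_eq_0_iff)
    with True show ?thesis by simp
  next
    case False
    then have "degree (pCons 0 (pderiv u)) = degree u"
      by (simp add: degree_pderiv pderiv_eq_0_iff)
    then show ?thesis
      using False coeff_mult_degree_sum[of "pCons 0 (pderiv u)" w]
      by (simp add: coeff_pCons coeff_pderiv split: nat.split)
  qed
  from this[of f g] this[of g f]
  have "of_nat (degree f) * (lead_coeff f * lead_coeff g)
      = of_nat (degree g) * (lead_coeff f * lead_coeff g)"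
    using calculation by (auto simp: mult.commute add.commute mult.assoc mult.left_commute)
  then show ?thesis
    using nz by simp
qed

text \<open>The combination \<open>r\<close> still has zero Wronskian with \<open>g\<close>, but its
  coefficient at the common degree cancels, so \<open>r\<close> must vanish. The cross-multiplied
  form avoids division, since the coefficients may themselves be polynomials in q.\<close>

lemma wronskian_zero_proportional:
  fixes f g :: "'a::{idom, ring_char_0} poly"
  assumes W: "pderiv f * g = f * pderiv g" and nz: "g \<noteq> 0"
  shows "smult (lead_coeff g) f = smult (lead_coeff f) g"
proof (rule ccontr)
  define r where "r = smult (lead_coeff g) f - smult (lead_coeff f) g"
  assume "\<not> ?thesis"
  then have r: "r \<noteq> 0" by (simp add: r_def)
  then have f: "f \<noteq> 0" by (auto simp: r_def)
  have "pderiv r * g = r * pderiv g"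
    unfolding r_def using W by (simp add: pderiv_diff pderiv_smult algebra_simps)
  then have "degree r = degree g"
    using r nz wronskian_zero_degree_eq by blast
  moreover have "degree f = degree g"
    using W f nz wronskian_zero_degree_eq by blast
  ultimately have "lead_coeff r = 0"
    by (simp add: r_def)
  with r show False by simp
qed

text \<open>Proportionality is applied twice: in p, which leaves a quotient of the polynomials
  \<open>u\<close> and \<open>w\<close> in q, and then in q, which leaves an element of the base
  field.\<close>

lemma rational_constant:
  fixes F :: "'k::field_char_0 poly poly fract"
  assumes dq0: "dq_rat F = 0" and dp0: "dp_rat F = 0"
  obtains c where "F = cst c"
proof (cases F)
  case (Fract a b)
  have "dp a * b = a * dp b"
    using dp0 Fract dp_rat_Fract[of b a] by (simp add: eq_fract Zero_fract_def)
  then have ab: "smult (lead_coeff b) a = smult (lead_coeff a) b"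
    using wronskian_zero_proportional Fract unfolding dp_def by blast
  define u w where "u = lead_coeff a" and "w = lead_coeff b"
  have w: "w \<noteq> 0" using Fract by (simp add: w_def)
  have F: "F = Fract [:u:] [:w:]"
    using ab Fract w by (simp add: eq_fract u_def w_def mult.commute)
  have "dq [:u:] * [:w:] = [:u:] * dq [:w:]"
    using dq0 F w dq_rat_Fract[of "[:w:]" "[:u:]"] by (simp add: eq_fract Zero_fract_def)
  then have "pderiv u * w = u * pderiv w"
    by (simp add: dq_def map_poly_pCons mult.commute)
  then have "smult (lead_coeff w) u = smult (lead_coeff u) w"
    using w by (rule wronskian_zero_proportional)
  then have "smult (lead_coeff u / lead_coeff w) w = u"
    using w by (metis (no_types, lifting) divide_self_if leading_coeff_0_iff mult.commute
        smult_1_left smult_smult times_divide_eq_right)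
  then have "F = cst (lead_coeff u / lead_coeff w)"
    using F w by (simp add: cst_def to_fract_def eq_fract)
  then show ?thesis ..
qed

text \<open>By the chain rule and the unit Jacobian determinant, H and K(X, Y) have equal partial
  derivatives. The differential conditions of a chart thus become one identity between
  functions.\<close>

lemma hamiltonian_form_potential:
  fixes H :: "'k::field_char_0 poly poly"
  assumes form: "hamiltonian_form H (X, Y) K"
    and symplectic: "dq_rat X * dp_rat Y - dp_rat X * dq_rat Y = 1"
  obtains c where "to_fract H = subst2 K X Y + cst c"
proof -
  have X: "dq_rat X * to_fract (dp H) - dp_rat X * to_fract (dq H) = subst2 (dp K) X Y"
    and Y: "dq_rat Y * to_fract (dp H) - dp_rat Y * to_fract (dq H) = - subst2 (dq K) X Y"
    using form by (simp_all add: hamiltonian_form_def time_deriv_def)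
  have kq: "subst2 (dq K) X Y = dp_rat Y * to_fract (dq H) - dq_rat Y * to_fract (dp H)"
    using Y by (simp add: algebra_simps)
  \<comment> \<open>The transposed Jacobian matrix is applied to the gradient of K; the gradient of
    H comes out, multiplied by the Jacobian determinant.\<close>
  have J: "subst2 (dq K) X Y * dq_rat X + subst2 (dp K) X Y * dq_rat Y
      = to_fract (dq H) * (dq_rat X * dp_rat Y - dp_rat X * dq_rat Y)"
    "subst2 (dq K) X Y * dp_rat X + subst2 (dp K) X Y * dp_rat Y
      = to_fract (dp H) * (dq_rat X * dp_rat Y - dp_rat X * dq_rat Y)"
    unfolding kq X[symmetric] by (simp_all add: algebra_simps)
  have "dq_rat (to_fract H - subst2 K X Y) = 0"
    unfolding dq.D_diff dq.D_to_fract chain_rule[OF dq.D_add dq.D_mult dq_rat_cst]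
    by (simp add: J symplectic)
  moreover have "dp_rat (to_fract H - subst2 K X Y) = 0"
    unfolding dp.D_diff dp.D_to_fract chain_rule[OF dp.D_add dp.D_mult dp_rat_cst]
    by (simp add: J symplectic)
  ultimately obtain c where "to_fract H - subst2 K X Y = cst c"
    by (rule rational_constant)
  then show ?thesis
    by (intro that[of c]) (simp add: algebra_simps)
qed

section \<open>Weights and regularity in the charts\<close>

text \<open>
  If \<open>H(q + s, p) = \<Sum> p\<^sup>n f\<^sub>n(qp) + \<Sum> q\<^sup>n e\<^sub>n(qp)\<close>, then \<open>diag_up s n H\<close> is \<open>f\<^sub>n\<close>, and for \<open>s = 0\<close>
  \<open>diag_down n H\<close> is \<open>e\<^sub>n\<close>.
\<close>

definition diag_up :: "'k::field \<Rightarrow> nat \<Rightarrow> 'k poly poly \<Rightarrow> 'k poly" where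
  "diag_up s n G = Poly (map (\<lambda>i. coeff (pcompose (coeff G (i + n)) [:s, 1:]) i) [0..<Suc (degree G)])"

definition diag_down :: "nat \<Rightarrow> 'k::field poly poly \<Rightarrow> 'k poly" where
  "diag_down n G = Poly (map (\<lambda>i. coeff (coeff G i) (i + n)) [0..<Suc (degree G)])"

text \<open>Rows beyond \<open>degree G\<close> vanish, so the truncated list in the definition
  loses no coefficient.\<close>

lemma coeff_diag_up: "coeff (diag_up s n G) i = coeff (pcompose (coeff G (i + n)) [:s, 1:]) i"
  by (simp add: diag_up_def nth_default_def coeff_eq_0 del: upt_Suc)

lemma coeff_diag_down: "coeff (diag_down n G) i = coeff (coeff G i) (i + n)"
  by (simp add: diag_down_def nth_default_def coeff_eq_0 del: upt_Suc)

lemma diag_up_add: "diag_up s n (F + G) = diag_up s n F + diag_up s n G"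
  by (rule poly_eqI) (simp add: coeff_diag_up pcompose_add)

lemma diag_down_add: "diag_down n (F + G) = diag_down n F + diag_down n G"
  by (rule poly_eqI) (simp add: coeff_diag_down)

lemma diag_up_0 [simp]: "diag_up s n 0 = 0"
  by (rule poly_eqI) (simp add: coeff_diag_up)

lemma diag_down_0 [simp]: "diag_down n 0 = 0"
  by (rule poly_eqI) (simp add: coeff_diag_down)

lemma diag_up_sum: "diag_up s n (sum f A) = (\<Sum>x\<in>A. diag_up s n (f x))"
  by (induction A rule: infinite_finite_induct) (simp_all add: diag_up_add)

lemma diag_down_sum: "diag_down n (sum f A) = (\<Sum>x\<in>A. diag_down n (f x))"
  by (induction A rule: infinite_finite_induct) (simp_all add: diag_down_add)

lemma diag_up_const_mult: "diag_up s n ([:[:c:]:] * G) = smult c (diag_up s n G)"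
  by (rule poly_eqI) (simp add: coeff_diag_up pcompose_smult)

lemma diag_down_const_mult: "diag_down n ([:[:c:]:] * G) = smult c (diag_down n G)"
  by (rule poly_eqI) (simp add: coeff_diag_down)

section \<open>The effect of multiplication on the weights\<close>

lemma diag_up_p_mult: "diag_up s (Suc n) (p_var * G) = diag_up s n G"
  by (rule poly_eqI) (simp add: coeff_diag_up p_var_def)

lemma diag_down_q_mult: "diag_down (Suc n) (q_var * G) = diag_down n G"
  by (rule poly_eqI) (simp add: coeff_diag_down q_var_def)

lemma diag_up_p_power_mult: "diag_up s (N + n) (p_var ^ N * G) = diag_up s n G"
  by (induction N) (simp_all add: diag_up_p_mult mult.assoc)

lemma diag_down_q_power_mult: "diag_down (N + n) (q_var ^ N * G) = diag_down n G"
  by (induction N) (simp_all add: diag_down_q_mult mult.assoc)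

text \<open>After the shift of q by s, the product p (q - s) has weight 0 and is the argument z of
  the diagonal polynomials, so it acts as multiplication by z in every weight.\<close>

lemma diag_up_qp_mult:
  "diag_up s n ((p_var * (q_var - [:[:s:]:])) * G) = pCons 0 (diag_up s n G)"
proof (rule poly_eqI)
  fix i
  define h where "h = [:- s, 1:]"
  have "p_var * (q_var - [:[:s:]:]) * G = pCons 0 (smult h G)"
    by (simp add: p_var_def q_var_def h_def)
  moreover have "pcompose h [:s, 1:] = [:0, 1:]"
    by (simp add: pcompose_pCons h_def)
  moreover have "poly h s = 0"
    by (simp add: h_def)
  ultimately show "coeff (diag_up s n (p_var * (q_var - [:[:s:]:]) * G)) i = coeff (pCons 0 (diag_up s n G)) i"
    by (cases i) (simp_all add: coeff_diag_up pcompose_mult coeff_pCons mult_pCons_left split: nat.split)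
qed

lemma diag_down_qp_mult: "diag_down n ((q_var * p_var) * G) = pCons 0 (diag_down n G)"
proof (rule poly_eqI)
  fix i
  have "q_var * p_var * G = pCons 0 (smult [:0, 1:] G)"
    by (simp add: p_var_def q_var_def)
  then show "coeff (diag_down n (q_var * p_var * G)) i = coeff (pCons 0 (diag_down n G)) i"
    by (cases i) (simp_all add: coeff_diag_down)
qed

lemma smult_const_uminus:
  fixes c :: "'k::comm_ring_1"
  shows "smult [:- c:] F = - smult [:c:] F"
  by (rule poly_eqI, rule poly_eqI) simp

lemma smult_const_one:
  fixes F :: "'k::comm_ring_1 poly poly"
  shows "smult [:1:] F = F"
  by (rule poly_eqI, rule poly_eqI) simp

text \<open>The factor a - p (q - s) has weight 0 and equals x / p in the charts with y = 1 / p; it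
  acts on each diagonal as a - z.\<close>

lemma diag_up_linear_power_mult:
  "diag_up s n ((- (p_var * (q_var - [:[:s:]:]) - [:[:a:]:])) ^ j * G) = [:a, - 1:] ^ j * diag_up s n G"
proof (induction j)
  case (Suc j)
  let ?L = "- (p_var * (q_var - [:[:s:]:]) - [:[:a:]:])"
  have L: "?L * F = [:[:a:]:] * F + [:[:- 1:]:] * ((p_var * (q_var - [:[:s:]:])) * F)" for F
    by (simp add: algebra_simps smult_const_uminus smult_const_one)
  have "diag_up s n (?L * F) = [:a, - 1:] * diag_up s n F" for F
    unfolding L diag_up_add diag_up_const_mult diag_up_qp_mult by simp
  with Suc show ?case
    by (simp only: power_Suc mult.assoc)
qed simp

text \<open>The analogue for the chart r_0, where the factor is y / q.\<close>

lemma diag_down_linear_power_mult: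
  "diag_down n ((- (q_var * p_var + [:[:a:]:])) ^ j * G) = [:- a, - 1:] ^ j * diag_down n G"
proof (induction j)
  case (Suc j)
  let ?L = "- (q_var * p_var + [:[:a:]:])"
  have L: "?L * F = [:[:- a:]:] * F + [:[:- 1:]:] * ((q_var * p_var) * F)" for F
    by (simp add: algebra_simps smult_const_uminus smult_const_one)
  have "diag_down n (?L * F) = [:- a, - 1:] * diag_down n F" for F
    unfolding L diag_down_add diag_down_const_mult diag_down_qp_mult by simp
  with Suc show ?case
    by (simp only: power_Suc mult.assoc)
qed simp

lemma p_var_power: "p_var ^ N = monom 1 N"
  by (simp add: p_var_def monom_altdef)

lemma q_var_power: "q_var ^ N = [:monom 1 N:]"
  by (simp add: q_var_def poly_const_pow monom_altdef)

lemma diag_up_p_power: "diag_up s n (p_var ^ N) = (if n = N then 1 else 0)"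
  by (rule poly_eqI) (auto simp: p_var_power coeff_diag_up one_pCons coeff_pCons pcompose_1 split: nat.split)

lemma diag_down_q_power: "diag_down n (q_var ^ N) = (if n = N then 1 else 0)"
  by (rule poly_eqI) (auto simp: q_var_power coeff_diag_down one_pCons coeff_pCons split: nat.split)

section \<open>Clearing denominators in K(x, y)\<close>

lemma subst1_sum:
  assumes "degree f \<le> N"
  shows "subst1 f X = (\<Sum>i\<le>N. cst (coeff f i) * X ^ i)"
proof -
  have "degree (map_poly cst f) \<le> N"
    using assms map_poly_degree_leq le_trans by blast
  then have "subst1 f X = (\<Sum>i\<le>N. coeff (map_poly cst f) i * X ^ i)"
    unfolding subst1_def poly_altdef
    by (intro sum.mono_neutral_left) (auto simp: coeff_eq_0 not_le)
  then show ?thesis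
    by (simp add: coeff_map_poly)
qed

lemma subst2_sum:
  assumes "degree K \<le> N" "\<And>j. degree (coeff K j) \<le> N"
  shows "subst2 K X Y = (\<Sum>j\<le>N. \<Sum>i\<le>N. cst (coeff (coeff K j) i) * X ^ i * Y ^ j)"
proof -
  have "degree (map_poly (\<lambda>f. subst1 f X) K) \<le> N"
    using assms(1) map_poly_degree_leq le_trans by blast
  then have "subst2 K X Y = (\<Sum>j\<le>N. coeff (map_poly (\<lambda>f. subst1 f X) K) j * Y ^ j)"
    unfolding subst2_subst1 poly_altdef
    by (intro sum.mono_neutral_left) (auto simp: coeff_eq_0 not_le)
  then show ?thesis
    by (simp add: coeff_map_poly subst1_sum[OF assms(2)] sum_distrib_right)
qed

lemma degree_coeff_bound:
  obtains N where "degree K \<le> N" "\<And>j. degree (coeff K j) \<le> N"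
proof
  let ?N = "degree K + (\<Sum>j\<le>degree K. degree (coeff K j))"
  show "degree K \<le> ?N" by simp
  show "degree (coeff K j) \<le> ?N" for j
  proof (cases "j \<le> degree K")
    case True
    then have "degree (coeff K j) \<le> (\<Sum>j\<le>degree K. degree (coeff K j))"
      by (intro member_le_sum) auto
    then show ?thesis by simp
  qed (simp add: coeff_eq_0)
qed

lemma to_fract_power: "to_fract (f ^ n) = to_fract f ^ n"
  by (induction n) simp_all

text \<open>A power N bounding all exponents removes the negative powers of p, so that the identity
  can be read in the polynomial ring, where diagonals make sense. The exponent
  \<open>N + i - j\<close> is never truncated because \<open>j \<le> N\<close>.\<close>

lemma subst2_up:
  fixes K :: "'k::field poly poly"
  assumes L: "X = to_fract (L * p_var)" and Y: "Y = 1 / to_fract p_var"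
    and N: "degree K \<le> N" "\<And>j. degree (coeff K j) \<le> N"
  shows "to_fract (p_var ^ N) * subst2 K X Y
    = to_fract (\<Sum>j\<le>N. \<Sum>i\<le>N. [:[:coeff (coeff K j) i:]:] * (L ^ i * p_var ^ (N + i - j)))"
proof -
  have p: "to_fract p_var \<noteq> (0 :: 'k poly poly fract)"
    by (simp add: p_var_def)
  have "to_fract p_var ^ N * Y ^ j * to_fract p_var ^ i = to_fract p_var ^ (N + i - j)" if "j \<le> N" for i j
    using that p by (simp add: Y power_divide field_simps flip: power_add)
  note cancel = this
  have expand: "to_fract (p_var ^ N) * (cst a * X ^ i * Y ^ j)
      = cst a * (to_fract L ^ i * (to_fract p_var ^ N * Y ^ j * to_fract p_var ^ i))" for a i j
    by (simp only: L power_mult_distrib to_fract_power to_fract_mult ac_simps)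
  have "to_fract (p_var ^ N) * (cst a * X ^ i * Y ^ j)
      = cst a * (to_fract L ^ i * to_fract p_var ^ (N + i - j))" if "j \<le> N" for a i j
    unfolding expand cancel[OF that] ..
  then show ?thesis
    unfolding subst2_sum[OF N] sum_distrib_left to_fract_sum
    by (intro sum.cong) (simp_all add: cst_def to_fract_power del: mult_pCons_left)
qed

lemma subst2_down:
  fixes K :: "'k::field poly poly"
  assumes X: "X = 1 / to_fract q_var" and L: "Y = to_fract (L * q_var)"
    and N: "degree K \<le> N" "\<And>j. degree (coeff K j) \<le> N"
  shows "to_fract (q_var ^ N) * subst2 K X Y
    = to_fract (\<Sum>j\<le>N. \<Sum>i\<le>N. [:[:coeff (coeff K j) i:]:] * (L ^ j * q_var ^ (N + j - i)))"
proof -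
  have q: "to_fract q_var \<noteq> (0 :: 'k poly poly fract)"
    by (simp add: q_var_def)
  have "to_fract q_var ^ N * X ^ i * to_fract q_var ^ j = to_fract q_var ^ (N + j - i)" if "i \<le> N" for i j
    using that q by (simp add: X power_divide field_simps flip: power_add)
  note cancel = this
  have expand: "to_fract (q_var ^ N) * (cst a * X ^ i * Y ^ j)
      = cst a * (to_fract L ^ j * (to_fract q_var ^ N * X ^ i * to_fract q_var ^ j))" for a i j
    by (simp only: L power_mult_distrib to_fract_power to_fract_mult ac_simps)
  have "to_fract (q_var ^ N) * (cst a * X ^ i * Y ^ j)
      = cst a * (to_fract L ^ j * to_fract q_var ^ (N + j - i))" if "i \<le> N" for a i j
    unfolding expand cancel[OF that] ..
  then show ?thesis
    unfolding subst2_sum[OF N] sum_distrib_left to_fract_sum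
    by (intro sum.cong) (simp_all add: cst_def to_fract_power del: mult_pCons_left)
qed

section \<open>Divisibility of the diagonals\<close>

lemma dq_q_var [simp]: "dq q_var = 1" and dp_q_var [simp]: "dp q_var = 0"
  and dq_p_var [simp]: "dq p_var = 0" and dp_p_var [simp]: "dp p_var = 1"
  by (simp_all add: dq_def dp_def q_var_def p_var_def map_poly_pCons pderiv_pCons one_pCons)

text \<open>A term x^i y^j equals L^i p^(i-j) with L = a - p (q - s) of weight 0. Weight n selects i
  = j + n, hence \<open>i \<ge> n\<close>, so every contribution carries (a - z)^n.\<close>

lemma diag_up_divisible:
  fixes H :: "'k::field_char_0 poly poly"
  assumes form: "hamiltonian_form H
      (- (to_fract p_var * (to_fract q_var - cst s) - cst a) * to_fract p_var, 1 / to_fract p_var) K"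
    and n: "n > 0"
  shows "[:- a, 1:] ^ n dvd diag_up s n H"
proof -
  define P where "P = (to_fract p_var :: 'k poly poly fract)"
  define Q where "Q = (to_fract q_var :: 'k poly poly fract)"
  define L where "L = - (p_var * (q_var - [:[:s:]:]) - [:[:a:]:])"
  have P0: "P \<noteq> 0" by (simp add: P_def p_var_def)
  have D: "dq_rat P = 0" "dq_rat Q = 1" "dp_rat P = 1" "dp_rat Q = 0"
    by (simp_all add: P_def Q_def dq.D_to_fract dp.D_to_fract)
  have "dq_rat (- (P * (Q - cst s) - cst a) * P) * dp_rat (1 / P)
      - dp_rat (- (P * (Q - cst s) - cst a) * P) * dq_rat (1 / P) = 1"
    using P0 by (simp add: D dq.D_mult dq.D_diff dq.D_uminus dq.D_inverse
        dp.D_mult dp.D_diff dp.D_uminus dp.D_inverse power2_eq_square)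
  then obtain c where c: "to_fract H = subst2 K (- (P * (Q - cst s) - cst a) * P) (1 / P) + cst c"
    using form hamiltonian_form_potential unfolding P_def Q_def by blast
  obtain N where N: "degree K \<le> N" "\<And>j. degree (coeff K j) \<le> N"
    using degree_coeff_bound[of K] by blast
  have "- (P * (Q - cst s) - cst a) * P = to_fract (L * p_var)"
    by (simp only: P_def Q_def L_def cst_def to_fract_mult to_fract_add to_fract_diff to_fract_uminus)
  note S = subst2_up[OF this P_def[THEN arg_cong[of _ _ "\<lambda>x. 1 / x"]] N]
  have "to_fract (p_var ^ N * H) = to_fract ((\<Sum>j\<le>N. \<Sum>i\<le>N. [:[:coeff (coeff K j) i:]:] * (L ^ i * p_var ^ (N + i - j)))
      + [:[:c:]:] * p_var ^ N)"
    unfolding to_fract_mult to_fract_add c distrib_left S[symmetric] cst_def by (simp add: mult.commute)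
  then have E: "p_var ^ N * H = (\<Sum>j\<le>N. \<Sum>i\<le>N. [:[:coeff (coeff K j) i:]:] * (L ^ i * p_var ^ (N + i - j)))
      + [:[:c:]:] * p_var ^ N"
    by (simp only: to_fract_eq_iff)
  \<comment> \<open>Multiplication by p^N only shifts the weight. The additive constant then sits in
    weight N alone and drops out because \<open>n > 0\<close>.\<close>
  have "diag_up s n H = diag_up s (N + n) (p_var ^ N * H)"
    by (simp add: diag_up_p_power_mult)
  also have "\<dots> = (\<Sum>j\<le>N. \<Sum>i\<le>N. smult (coeff (coeff K j) i) ([:a, - 1:] ^ i * (if N + n = N + i - j then 1 else 0)))"
    unfolding E diag_up_add diag_up_sum diag_up_const_mult L_def diag_up_linear_power_mult diag_up_p_power
    using n by simp
  finally have *: "diag_up s n H = \<dots>" .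
  have "[:- a, 1:] ^ n dvd [:a, - 1:] ^ i" if "n \<le> i" for i
  proof -
    have "[:a, - 1:] = - [:- a, 1:]" by simp
    then have "[:- a, 1:] dvd [:a, - 1:]" by (metis dvd_minus_iff dvd_refl)
    then show ?thesis using that by (meson dvd_power_same dvd_trans le_imp_power_dvd)
  qed
  then have "[:- a, 1:] ^ n dvd [:a, - 1:] ^ i * (if N + n = N + i - j then 1 else 0)" for i j
    by (cases "n \<le> i") auto
  then show ?thesis
    unfolding * by (intro dvd_sum dvd_smult)
qed

text \<open>An exact formula and not just a divisibility, because r_8 imposes its condition on K.
  Weight -n of H corresponds to weight n of K, and x y = -(q p + a) accounts for the substitution of
  -a - z for z.\<close>

lemma diag_down_eq:
  fixes H :: "'k::field_char_0 poly poly"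
  assumes form: "hamiltonian_form H
      (1 / to_fract q_var, - (to_fract q_var * to_fract p_var + cst a) * to_fract q_var) K"
    and n: "n > 0"
  shows "diag_down n H = [:- a, - 1:] ^ n * pcompose (diag_up 0 n K) [:- a, - 1:]"
proof -
  define P where "P = (to_fract p_var :: 'k poly poly fract)"
  define Q where "Q = (to_fract q_var :: 'k poly poly fract)"
  define L where "L = - (q_var * p_var + [:[:a:]:])"
  have Q0: "Q \<noteq> 0" by (simp add: Q_def q_var_def)
  have D: "dq_rat P = 0" "dq_rat Q = 1" "dp_rat P = 1" "dp_rat Q = 0"
    by (simp_all add: P_def Q_def dq.D_to_fract dp.D_to_fract)
  have "dq_rat (1 / Q) * dp_rat (- (Q * P + cst a) * Q)
      - dp_rat (1 / Q) * dq_rat (- (Q * P + cst a) * Q) = 1"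
    using Q0 by (simp add: D dq.D_mult dq.D_add dq.D_uminus dq.D_inverse
        dp.D_mult dp.D_add dp.D_diff dp.D_uminus dp.D_inverse dq.D_diff power2_eq_square)
  then obtain c where c: "to_fract H = subst2 K (1 / Q) (- (Q * P + cst a) * Q) + cst c"
    using form hamiltonian_form_potential unfolding P_def Q_def by blast
  obtain N where N: "degree K \<le> N" "\<And>j. degree (coeff K j) \<le> N"
    using degree_coeff_bound[of K] by blast
  have "- (Q * P + cst a) * Q = to_fract (L * q_var)"
    by (simp only: P_def Q_def L_def cst_def to_fract_mult to_fract_add to_fract_diff to_fract_uminus)
  note S = subst2_down[OF Q_def[THEN arg_cong[of _ _ "\<lambda>x. 1 / x"]] this N]
  have "to_fract (q_var ^ N * H) = to_fract ((\<Sum>j\<le>N. \<Sum>i\<le>N. [:[:coeff (coeff K j) i:]:] * (L ^ j * q_var ^ (N + j - i)))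
      + [:[:c:]:] * q_var ^ N)"
    unfolding to_fract_mult to_fract_add c distrib_left S[symmetric] cst_def by (simp add: mult.commute)
  then have E: "q_var ^ N * H = (\<Sum>j\<le>N. \<Sum>i\<le>N. [:[:coeff (coeff K j) i:]:] * (L ^ j * q_var ^ (N + j - i)))
      + [:[:c:]:] * q_var ^ N"
    by (simp only: to_fract_eq_iff)
  have "diag_down n H = diag_down (N + n) (q_var ^ N * H)"
    by (simp add: diag_down_q_power_mult)
  also have "\<dots> = (\<Sum>j\<le>N. \<Sum>i\<le>N. smult (coeff (coeff K j) i) ([:- a, - 1:] ^ j * (if N + n = N + j - i then 1 else 0)))"
    unfolding E diag_down_add diag_down_sum diag_down_const_mult L_def diag_down_linear_power_mult diag_down_q_power
    using n by simp
  \<comment> \<open>Exchanging the sums lets \<open>j = i + n\<close> collapse the inner one; what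
    remains is a diagonal of K.\<close>
  also have "\<dots> = (\<Sum>i\<le>N. \<Sum>j\<le>N. if j = i + n then smult (coeff (coeff K j) i) ([:- a, - 1:] ^ j) else 0)"
    by (subst sum.swap) (intro sum.cong, auto)
  also have "\<dots> = (\<Sum>i\<le>N. smult (coeff (coeff K (i + n)) i) ([:- a, - 1:] ^ (i + n)))"
    using N(1) by (intro sum.cong) (auto simp: coeff_eq_0)
  also have "\<dots> = [:- a, - 1:] ^ n * (\<Sum>i\<le>N. smult (coeff (diag_up 0 n K) i) ([:- a, - 1:] ^ i))"
    by (simp add: coeff_diag_up power_add sum_distrib_left mult.commute)
  also have "(\<Sum>i\<le>N. smult (coeff (diag_up 0 n K) i) ([:- a, - 1:] ^ i)) = pcompose (diag_up 0 n K) [:- a, - 1:]"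
  proof -
    have "coeff (diag_up 0 n K) i = 0" if "i > N" for i
      using that N by (simp add: coeff_diag_up coeff_eq_0)
    then have deg: "degree (diag_up 0 n K) \<le> N"
      by (intro degree_le) auto
    have "pcompose (diag_up 0 n K) [:- a, - 1:]
        = (\<Sum>i\<le>degree (diag_up 0 n K). smult (coeff (diag_up 0 n K) i) ([:- a, - 1:] ^ i))"
      unfolding pcompose_altdef poly_altdef
      by (simp add: coeff_map_poly degree_map_poly)
    also have "\<dots> = (\<Sum>i\<le>N. smult (coeff (diag_up 0 n K) i) ([:- a, - 1:] ^ i))"
      using deg by (intro sum.mono_neutral_left) (auto simp: coeff_eq_0 not_le)
    finally show ?thesis ..
  qed
  finally show ?thesis .
qed

lemma pcompose_power: "pcompose (p ^ n) q = pcompose p q ^ n"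
  by (induction n) (simp_all add: pcompose_1 pcompose_mult)

text \<open>The chart r_0 splits off (-a - z)^n explicitly, and r_8 makes (-(a + b) - z)^n divide
  the cofactor. Hence the product divides even when the two roots coincide.\<close>

lemma diag_down_divisible:
  fixes H :: "'k::field_char_0 poly poly"
  assumes form: "hamiltonian_form H
      (1 / to_fract q_var, - (to_fract q_var * to_fract p_var + cst a) * to_fract q_var) K"
    and form': "hamiltonian_form K
      (- (to_fract p_var * (to_fract q_var - cst 0) - cst b) * to_fract p_var, 1 / to_fract p_var) K'"
    and n: "n > 0"
  shows "[:a * (a + b), 2 * a + b, 1:] ^ n dvd diag_down n H"
proof -
  have "pcompose ([:- b, 1:] ^ n) [:- a, - 1:] dvd pcompose (diag_up 0 n K) [:- a, - 1:]"
    using diag_up_divisible[OF form' n] by (auto simp: dvd_def pcompose_mult)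
  moreover have "pcompose [:- b, 1:] [:- a, - 1:] = [:- (a + b), - 1:]"
    by (simp add: pcompose_pCons)
  then have "pcompose ([:- b, 1:] ^ n) [:- a, - 1:] = [:- (a + b), - 1:] ^ n"
    by (simp only: pcompose_power)
  ultimately have "([:- a, - 1:] * [:- (a + b), - 1:]) ^ n dvd diag_down n H"
    unfolding diag_down_eq[OF form n] power_mult_distrib by (simp add: mult_dvd_mono)
  moreover have "[:- a, - 1:] * [:- (a + b), - 1:] = [:a * (a + b), 2 * a + b, 1:]"
    by (simp add: algebra_simps)
  ultimately show ?thesis by simp
qed

section \<open>Products of linear factors\<close>

text \<open>The product over the earlier roots does not vanish at a new root \<open>b\<close>, so
  the whole order of \<open>f\<close> at \<open>b\<close> lies in the cofactor
  \<open>g\<close>.\<close>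

lemma linear_powers_dvd:
  fixes f :: "'k::idom poly"
  assumes "finite A" "\<And>a. a \<in> A \<Longrightarrow> [:- a, 1:] ^ n dvd f"
  shows "(\<Prod>a\<in>A. [:- a, 1:] ^ n) dvd f"
  using assms
proof (induction A rule: finite_induct)
  case (insert b A)
  let ?P = "\<Prod>a\<in>A. [:- a, 1:] ^ n"
  obtain g where f: "f = ?P * g"
    using insert by (auto simp: dvd_def)
  have "[:- b, 1:] ^ n dvd g"
  proof (cases "f = 0")
    case True
    have "?P \<noteq> 0" using insert.hyps by simp
    with f True show ?thesis by (metis dvd_0_right mult_eq_0_iff)
  next
    case False
    have "poly ?P b \<noteq> 0"
      using insert.hyps by (auto simp: poly_prod)
    then have "order b f = order b g"
      using False f by (simp add: order_mult order_0I)
    moreover have "n \<le> order b f"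
      using insert.prems[of b] False by (simp add: order_divides)
    ultimately show ?thesis by (simp add: order_divides)
  qed
  then have "[:- b, 1:] ^ n * ?P dvd g * ?P"
    by (rule mult_dvd_mono) simp
  then show ?case
    using insert.hyps f by (simp add: mult.commute)
qed simp

text \<open>Vieta's formula: in the expansion, S is the set of factors that contribute their
  constant term, and the remaining factors contribute the power of the variable.\<close>

lemma coeff_linear_prod:
  fixes r :: "'i \<Rightarrow> 'k::comm_ring_1"
  assumes "finite A" "j \<le> card A"
  shows "coeff (\<Prod>k\<in>A. [:- r k, 1:]) (card A - j)
    = (- 1) ^ j * (\<Sum>S | S \<subseteq> A \<and> card S = j. \<Prod>k\<in>S. r k)"
proof -
  have "(\<Prod>k\<in>A. [:- r k, 1:]) = (\<Prod>k\<in>A. [:- r k:] + monom 1 1)"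
    by (simp add: monom_altdef)
  also have "\<dots> = (\<Sum>S\<in>Pow A. (\<Prod>k\<in>S. [:- r k:]) * (\<Prod>k\<in>A - S. monom 1 1))"
    using assms by (intro prod_add)
  also have "\<dots> = (\<Sum>S\<in>Pow A. smult ((- 1) ^ card S * (\<Prod>k\<in>S. r k)) (monom 1 (card A - card S)))"
  proof (rule sum.cong[OF refl])
    fix S assume "S \<in> Pow A"
    then have S: "finite S" "S \<subseteq> A" using assms finite_subset by auto
    have "(\<Prod>k\<in>S. [:- r k:]) = [:(- 1) ^ card S * (\<Prod>k\<in>S. r k):]"
      using S(1) by (induction S rule: finite_induct) (simp_all add: one_pCons algebra_simps)
    then show "(\<Prod>k\<in>S. [:- r k:]) * (\<Prod>k\<in>A - S. monom 1 1)
        = smult ((- 1) ^ card S * (\<Prod>k\<in>S. r k)) (monom 1 (card A - card S))"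
      using S by (simp add: card_Diff_subset monom_power)
  qed
  finally have "coeff (\<Prod>k\<in>A. [:- r k, 1:]) (card A - j)
      = (\<Sum>S\<in>Pow A. if card A - card S = card A - j then (- 1) ^ card S * (\<Prod>k\<in>S. r k) else 0)"
    by (simp add: coeff_sum if_distrib cong: if_cong)
  also have "\<dots> = (\<Sum>S\<in>Pow A. if card S = j then (- 1) ^ j * (\<Prod>k\<in>S. r k) else 0)"
  proof (rule sum.cong[OF refl])
    fix S assume "S \<in> Pow A"
    then have "card S \<le> card A" using assms by (auto intro: card_mono)
    with assms(2) have "card A - card S = card A - j \<longleftrightarrow> card S = j" by auto
    then show "(if card A - card S = card A - j then (- 1) ^ card S * (\<Prod>k\<in>S. r k) else 0)
        = (if card S = j then (- 1) ^ j * (\<Prod>k\<in>S. r k) else 0)"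
      by auto
  qed
  also have "\<dots> = (- 1) ^ j * (\<Sum>S | S \<subseteq> A \<and> card S = j. \<Prod>k\<in>S. r k)"
    using assms(1) by (simp add: sum.If_cases sum_distrib_left Int_def Pow_def conj_commute)
  finally show ?thesis .
qed

text \<open>With \<open>degree_le_exp\<close>, this turns a divisibility into equations with
  finitely many unknown cofactor coefficients.\<close>

lemma dvd_cofactor:
  fixes f g :: "'k::idom poly"
  assumes "g dvd f" "g \<noteq> 0" "degree f \<le> degree g + m"
  obtains u where "f = g * u" "degree u \<le> m"
proof -
  obtain u where u: "f = g * u" using assms(1) by (auto simp: dvd_def)
  have "degree u \<le> m"
    using assms(2,3) u by (cases "u = 0") (simp_all add: degree_mult_eq)
  with u that show thesis by blast
qed

lemma degree_le_exp:
  "degree u \<le> 0 \<Longrightarrow> u = [:coeff u 0:]"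
  "degree u \<le> 1 \<Longrightarrow> u = [:coeff u 0, coeff u 1:]"
  "degree u \<le> 2 \<Longrightarrow> u = [:coeff u 0, coeff u 1, coeff u 2:]"
  "degree u \<le> 3 \<Longrightarrow> u = [:coeff u 0, coeff u 1, coeff u 2, coeff u 3:]"
  "degree u \<le> 4 \<Longrightarrow> u = [:coeff u 0, coeff u 1, coeff u 2, coeff u 3, coeff u 4:]"
  "degree u \<le> 9 \<Longrightarrow> u = [:coeff u 0, coeff u 1, coeff u 2, coeff u 3, coeff u 4,
     coeff u 5, coeff u 6, coeff u 7, coeff u 8, coeff u 9:]"
  by (rule poly_eqI, simp add: coeff_pCons coeff_eq_0 eval_nat_numeral split: nat.split)+

text \<open>Binomial expansion at 1. The bound 9 is the one that \<open>degree_row\<close>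
  establishes for the rows of H.\<close>

lemma coeff_shift:
  fixes u :: "'k::comm_ring_1 poly"
  assumes "degree u \<le> 9"
  shows "coeff (pcompose u [:1, 1:]) 0 = coeff u 0 + coeff u 1 + coeff u 2 + coeff u 3 + coeff u 4
      + coeff u 5 + coeff u 6 + coeff u 7 + coeff u 8 + coeff u 9"
    "coeff (pcompose u [:1, 1:]) 1 = coeff u 1 + 2 * coeff u 2 + 3 * coeff u 3 + 4 * coeff u 4
      + 5 * coeff u 5 + 6 * coeff u 6 + 7 * coeff u 7 + 8 * coeff u 8 + 9 * coeff u 9"
    "coeff (pcompose u [:1, 1:]) 2 = coeff u 2 + 3 * coeff u 3 + 6 * coeff u 4
      + 10 * coeff u 5 + 15 * coeff u 6 + 21 * coeff u 7 + 28 * coeff u 8 + 36 * coeff u 9"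
    "coeff (pcompose u [:1, 1:]) 3 = coeff u 3 + 4 * coeff u 4
      + 10 * coeff u 5 + 20 * coeff u 6 + 35 * coeff u 7 + 56 * coeff u 8 + 84 * coeff u 9"
    "coeff (pcompose u [:1, 1:]) 4 = coeff u 4
      + 5 * coeff u 5 + 15 * coeff u 6 + 35 * coeff u 7 + 70 * coeff u 8 + 126 * coeff u 9"
    "coeff (pcompose u [:1, 1:]) 5 =
      coeff u 5 + 6 * coeff u 6 + 21 * coeff u 7 + 56 * coeff u 8 + 126 * coeff u 9"
proof -
  obtain u0 u1 u2 u3 u4 u5 u6 u7 u8 u9 where u: "u = [:u0, u1, u2, u3, u4, u5, u6, u7, u8, u9:]"
    using degree_le_exp(6)[OF assms] by blast
  have "pcompose u [:1, 1:] = [: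
    u0 + u1 + u2 + u3 + u4 + u5 + u6 + u7 + u8 + u9,
    u1 + 2 * u2 + 3 * u3 + 4 * u4 + 5 * u5 + 6 * u6 + 7 * u7 + 8 * u8 + 9 * u9,
    u2 + 3 * u3 + 6 * u4 + 10 * u5 + 15 * u6 + 21 * u7 + 28 * u8 + 36 * u9,
    u3 + 4 * u4 + 10 * u5 + 20 * u6 + 35 * u7 + 56 * u8 + 84 * u9,
    u4 + 5 * u5 + 15 * u6 + 35 * u7 + 70 * u8 + 126 * u9,
    u5 + 6 * u6 + 21 * u7 + 56 * u8 + 126 * u9,
    u6 + 7 * u7 + 28 * u8 + 84 * u9, u7 + 8 * u8 + 36 * u9, u8 + 9 * u9, u9:]"
    unfolding u by (simp add: pcompose_pCons)
  then show "coeff (pcompose u [:1, 1:]) 0 = coeff u 0 + coeff u 1 + coeff u 2 + coeff u 3 + coeff u 4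
      + coeff u 5 + coeff u 6 + coeff u 7 + coeff u 8 + coeff u 9"
    "coeff (pcompose u [:1, 1:]) 1 = coeff u 1 + 2 * coeff u 2 + 3 * coeff u 3 + 4 * coeff u 4
      + 5 * coeff u 5 + 6 * coeff u 6 + 7 * coeff u 7 + 8 * coeff u 8 + 9 * coeff u 9"
    "coeff (pcompose u [:1, 1:]) 2 = coeff u 2 + 3 * coeff u 3 + 6 * coeff u 4
      + 10 * coeff u 5 + 15 * coeff u 6 + 21 * coeff u 7 + 28 * coeff u 8 + 36 * coeff u 9"
    "coeff (pcompose u [:1, 1:]) 3 = coeff u 3 + 4 * coeff u 4
      + 10 * coeff u 5 + 20 * coeff u 6 + 35 * coeff u 7 + 56 * coeff u 8 + 84 * coeff u 9"
    "coeff (pcompose u [:1, 1:]) 4 = coeff u 4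
      + 5 * coeff u 5 + 15 * coeff u 6 + 35 * coeff u 7 + 70 * coeff u 8 + 126 * coeff u 9"
    "coeff (pcompose u [:1, 1:]) 5 =
      coeff u 5 + 6 * coeff u 6 + 21 * coeff u 7 + 56 * coeff u 8 + 126 * coeff u 9"
    unfolding u by (simp_all add: eval_nat_numeral)
qed

text \<open>A row supported on q^4, ..., q^8 vanishes to order three at q = 1 and has
  \<open>s\<close> as its next Taylor coefficient there. The top coefficient stays a
  parameter.\<close>

lemma binomial_system:
  fixes x\<^sub>0 x\<^sub>1 x\<^sub>2 x\<^sub>3 x\<^sub>4 s :: "'k::field_char_0"
  assumes "x\<^sub>0 + x\<^sub>1 + x\<^sub>2 + x\<^sub>3 + x\<^sub>4 = 0"
    "4 * x\<^sub>0 + 5 * x\<^sub>1 + 6 * x\<^sub>2 + 7 * x\<^sub>3 + 8 * x\<^sub>4 = 0"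
    "6 * x\<^sub>0 + 10 * x\<^sub>1 + 15 * x\<^sub>2 + 21 * x\<^sub>3 + 28 * x\<^sub>4 = 0"
    "4 * x\<^sub>0 + 10 * x\<^sub>1 + 20 * x\<^sub>2 + 35 * x\<^sub>3 + 56 * x\<^sub>4 = s"
  shows "x\<^sub>0 = x\<^sub>4 - s" "x\<^sub>1 = 3 * s - 4 * x\<^sub>4" "x\<^sub>2 = 6 * x\<^sub>4 - 3 * s" "x\<^sub>3 = s - 4 * x\<^sub>4"
  using assms by algebra+

section \<open>The linear system for the coefficients\<close>

text \<open>The conditions on H in purely algebraic form, with all parameters in the coefficient
  field. Here \<open>r k\<close> stands for rho_k, and \<open>relation\<close> is the linear
  relation of the \<alpha>, regrouped.\<close>

locale degree_15_candidate =
  fixes H :: "'k::field_char_0 poly poly" and r :: "nat \<Rightarrow> 'k" and \<kappa> \<epsilon> \<gamma>\<^sub>1 \<gamma>\<^sub>2 :: 'k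
  assumes total_degree: "\<And>i j. coeff (coeff H j) i \<noteq> 0 \<Longrightarrow> i + j \<le> 15"
    and up_0: "\<And>n k. n > 0 \<Longrightarrow> k \<in> {1..5} \<Longrightarrow> [:- r k, 1:] ^ n dvd diag_up 0 n H"
    and distinct: "card (r ` {1..5}) \<ge> 4"
    and up_1: "\<And>n. n > 0 \<Longrightarrow> [:\<gamma>\<^sub>2, - \<gamma>\<^sub>1, 1:] ^ n dvd diag_up 1 n H"
    and down: "\<And>n. n > 0 \<Longrightarrow> [:\<epsilon>, \<kappa>, 1:] ^ n dvd diag_down n H"
    and relation: "3 * \<kappa> + 2 * \<gamma>\<^sub>1 + (\<Sum>k=1..5. r k) = 0"
begin

abbreviation h :: "nat \<Rightarrow> nat \<Rightarrow> 'k" where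
  "h j i \<equiv> coeff (coeff H j) i"

definition \<beta> :: "nat \<Rightarrow> 'k" where
  "\<beta> j = (\<Sum>S | S \<subseteq> {1..5} \<and> card S = j. \<Prod>k\<in>S. r k)"

text \<open>Multiplying the divisibilities needs distinct roots, so one index is set aside; four
  factors suffice for the degree count.\<close>

lemma four_distinct:
  obtains k where "k \<in> {1..5}" "inj_on r ({1..5} - {k})"
proof -
  obtain B where B: "B \<subseteq> r ` {1..5}" "card B = 4"
    using distinct obtain_subset_with_card_n by metis
  obtain A where A: "A \<subseteq> {1..5}" "inj_on r A" "B = r ` A"
    using B(1) by (auto simp: subset_image_inj)
  have "card A = 4" using A B by (simp add: card_image)
  then have "card ({1..5} - A) = 1"
    using A by (subst card_Diff_subset) (auto intro: finite_subset)
  then obtain k where k: "{1..5} - A = {k}" by (auto simp: card_1_singleton_iff)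
  then have "{1..5} - {k} = A" "k \<in> {1..5}" using A by auto
  with A that show thesis by blast
qed

section \<open>Degree counts and the support of H\<close>

lemma linear_factors_up_0:
  assumes "n > 0" and k: "k \<in> {1..5}" "inj_on r ({1..5} - {k})"
  shows "(\<Prod>l\<in>{1..5} - {k}. [:- r l, 1:]) ^ n dvd diag_up 0 n H"
proof -
  have "(\<Prod>a\<in>r ` ({1..5} - {k}). [:- a, 1:] ^ n) dvd diag_up 0 n H"
    using up_0 assms(1) by (intro linear_powers_dvd) auto
  then show ?thesis
    using k by (simp add: prod.reindex prod_power_distrib)
qed

lemma degree_linear_factors: "degree (\<Prod>l\<in>A. [:- r l, 1:]) = card A"
  by (subst degree_prod_sum_eq) auto

text \<open>Four distinct factors force a degree d of at least 4n, while the top monomial q^d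
  p^(d+n) requires 2d + n \<le> 15. Together 9n \<le> 15.\<close>

lemma up_0_eq_0:
  assumes "n \<ge> 2"
  shows "diag_up 0 n H = 0"
proof (rule ccontr)
  assume nz: "\<not> ?thesis"
  obtain k where k: "k \<in> {1..5}" "inj_on r ({1..5} - {k})"
    by (rule four_distinct)
  let ?d = "degree (diag_up 0 n H)"
  have "4 * n = degree ((\<Prod>l\<in>{1..5} - {k}. [:- r l, 1:]) ^ n)"
    using k(1) by (subst degree_power_eq) (auto simp: degree_linear_factors card_Diff_singleton)
  also have "\<dots> \<le> ?d"
    using linear_factors_up_0[OF _ k] assms nz by (intro dvd_imp_degree_le) auto
  finally have "4 * n \<le> ?d" .
  moreover have "coeff (diag_up 0 n H) ?d \<noteq> 0" using nz by simp
  then have "?d + (?d + n) \<le> 15"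
    using total_degree by (simp add: coeff_diag_up)
  ultimately show False using assms by linarith
qed

text \<open>The top monomial is q^(d+n) p^d. Both bounds together give 5n \<le> 15, and for n = 3
  they leave only d = 6.\<close>

lemma down_degree:
  assumes "diag_down n H \<noteq> 0"
  shows "2 * degree (diag_down n H) + n \<le> 15" "n > 0 \<Longrightarrow> 2 * n \<le> degree (diag_down n H)"
proof -
  let ?d = "degree (diag_down n H)"
  have "coeff (diag_down n H) ?d \<noteq> 0" using assms by simp
  then show "2 * ?d + n \<le> 15"
    using total_degree[of ?d "?d + n"] by (simp add: coeff_diag_down)
  assume "n > 0"
  then have "degree ([:\<epsilon>, \<kappa>, 1:] ^ n) \<le> ?d"
    using down assms by (intro dvd_imp_degree_le) auto
  then show "2 * n \<le> ?d"
    by (subst (asm) degree_power_eq) auto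
qed

lemma down_eq_0: "n \<ge> 4 \<Longrightarrow> diag_down n H = 0"
  using down_degree[of n] by fastforce

text \<open>The vanishing weights confine the exponents to a strip; together with the total degree
  this bounds i by 9 and j by 8.\<close>

lemma support:
  assumes "h j i \<noteq> 0"
  shows "j \<le> i + 1" "i \<le> j + 3" "i + j \<le> 15"
proof -
  show "i + j \<le> 15" using assms total_degree by blast
  show "j \<le> i + 1"
  proof (rule ccontr)
    assume "\<not> ?thesis"
    then have "diag_up 0 (j - i) H = 0" by (intro up_0_eq_0) simp
    from arg_cong[OF this, of "\<lambda>u. coeff u i"] \<open>\<not> ?thesis\<close> assms show False
      by (simp add: coeff_diag_up)
  qed
  show "i \<le> j + 3"
  proof (rule ccontr)
    assume "\<not> ?thesis"
    then have "diag_down (i - j) H = 0" by (intro down_eq_0) simp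
    from arg_cong[OF this, of "\<lambda>u. coeff u j"] \<open>\<not> ?thesis\<close> assms show False
      by (simp add: coeff_diag_down)
  qed
qed

lemma outside_support: "j > i + 1 \<or> i > j + 3 \<or> i + j > 15 \<Longrightarrow> h j i = 0"
  using support[of j i] by fastforce

lemma degree_row: "degree (coeff H j) \<le> 9"
proof (intro degree_le allI impI outside_support)
  fix i :: nat
  assume "9 < i"
  then show "j > i + 1 \<or> i > j + 3 \<or> i + j > 15" by linarith
qed

section \<open>Taylor coefficients at q = 1 and the vanishing of high rows\<close>

definition t :: "nat \<Rightarrow> nat \<Rightarrow> 'k" where
  "t j i = coeff (pcompose (coeff H j) [:1, 1:]) i"

lemma t_eq:
  "t j 0 = h j 0 + h j 1 + h j 2 + h j 3 + h j 4 + h j 5 + h j 6 + h j 7 + h j 8 + h j 9"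
  "t j 1 = h j 1 + 2 * h j 2 + 3 * h j 3 + 4 * h j 4 + 5 * h j 5 + 6 * h j 6 + 7 * h j 7
    + 8 * h j 8 + 9 * h j 9"
  "t j 2 = h j 2 + 3 * h j 3 + 6 * h j 4 + 10 * h j 5 + 15 * h j 6 + 21 * h j 7 + 28 * h j 8
    + 36 * h j 9"
  "t j 3 = h j 3 + 4 * h j 4 + 10 * h j 5 + 20 * h j 6 + 35 * h j 7 + 56 * h j 8 + 84 * h j 9"
  "t j 4 = h j 4 + 5 * h j 5 + 15 * h j 6 + 35 * h j 7 + 70 * h j 8 + 126 * h j 9"
  "t j 5 = h j 5 + 6 * h j 6 + 21 * h j 7 + 56 * h j 8 + 126 * h j 9"
  unfolding t_def by (fact coeff_shift[OF degree_row])+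

lemma coeff_up_1: "coeff (diag_up 1 n H) i = t (i + n) i"
  by (simp add: coeff_diag_up t_def)

lemma row_eq_0: "j \<ge> 9 \<Longrightarrow> coeff H j = 0"
  by (rule poly_eqI) (auto intro: outside_support)

text \<open>The rows from p^9 on vanish, so d + n \<le> 8, whereas the quadratic factor forces 2n
  \<le> d. Together 3n \<le> 8.\<close>

lemma up_1_eq_0:
  assumes "n \<ge> 3"
  shows "diag_up 1 n H = 0"
proof (rule ccontr)
  assume nz: "\<not> ?thesis"
  let ?d = "degree (diag_up 1 n H)"
  have "t (?d + n) ?d \<noteq> 0"
    using nz by (simp flip: coeff_up_1)
  then have "?d + n \<le> 8"
    using row_eq_0[of "?d + n"] by (force simp: t_def)
  moreover have "degree ([:\<gamma>\<^sub>2, - \<gamma>\<^sub>1, 1:] ^ n) \<le> ?d"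
    using up_1 nz assms by (intro dvd_imp_degree_le) auto
  then have "2 * n \<le> ?d"
    by (subst (asm) degree_power_eq) auto
  ultimately show False using assms by linarith
qed

text \<open>Row j is thus divisible by (q - 1)^(j-2), which gives linear equations for its
  coefficients.\<close>

lemma t_eq_0: "j \<ge> i + 3 \<Longrightarrow> t j i = 0"
  using coeff_up_1[of "j - i" i] up_1_eq_0[of "j - i"] by simp

text \<open>The support leaves only q^7, whose coefficient is the value at q = 1.\<close>

lemma row_8: "coeff H 8 = 0"
proof -
  have "h 8 7 = 0"
    using t_eq_0[of 0 8] unfolding t_eq by (simp add: outside_support)
  then show ?thesis
    by (subst degree_le_exp(6)[OF degree_row]) (simp add: outside_support)
qed

text \<open>Only q^6, q^7 and q^8 are possible, and three Taylor conditions already exclude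
  them.\<close>

lemma row_7: "coeff H 7 = 0"
proof -
  have "h 7 6 + h 7 7 + h 7 8 = 0" "6 * h 7 6 + 7 * h 7 7 + 8 * h 7 8 = 0"
    "15 * h 7 6 + 21 * h 7 7 + 28 * h 7 8 = 0"
    using t_eq_0[of 0 7] t_eq_0[of 1 7] t_eq_0[of 2 7] unfolding t_eq
    by (simp_all add: outside_support)
  then have "h 7 6 = 0 \<and> h 7 7 = 0 \<and> h 7 8 = 0" by algebra
  then show ?thesis
    by (subst degree_le_exp(6)[OF degree_row]) (simp add: outside_support)
qed

lemma row_ge_7: "j \<ge> 7 \<Longrightarrow> coeff H j = 0"
proof -
  assume "j \<ge> 7"
  then consider "j = 7" | "j = 8" | "j \<ge> 9" by linarith
  then show ?thesis by cases (simp_all add: row_7 row_8 row_eq_0)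
qed

section \<open>The leading coefficient c and the unknowns of each weight\<close>

definition c :: 'k where "c = h 6 9"

text \<open>Five admissible coefficients and four vanishing conditions at q = 1 leave c q^5 (q -
  1)^4.\<close>

lemma row_6: "h 6 5 = c" "h 6 6 = - 4 * c" "h 6 7 = 6 * c" "h 6 8 = - 4 * c" "h 6 9 = c"
proof -
  have "h 6 5 + h 6 6 + h 6 7 + h 6 8 + c = 0"
    "5 * h 6 5 + 6 * h 6 6 + 7 * h 6 7 + 8 * h 6 8 + 9 * c = 0"
    "10 * h 6 5 + 15 * h 6 6 + 21 * h 6 7 + 28 * h 6 8 + 36 * c = 0"
    "10 * h 6 5 + 20 * h 6 6 + 35 * h 6 7 + 56 * h 6 8 + 84 * c = 0"
    using t_eq_0[of 0 6] t_eq_0[of 1 6] t_eq_0[of 2 6] t_eq_0[of 3 6] unfolding t_eq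
    by (simp_all add: outside_support c_def)
  then show "h 6 5 = c" "h 6 6 = - 4 * c" "h 6 7 = 6 * c" "h 6 8 = - 4 * c"
    by algebra+
qed (simp add: c_def)

lemma beta_1: "\<beta> 1 = (\<Sum>k=1..5. r k)"
proof -
  have "{S. S \<subseteq> {1..5::nat} \<and> card S = 1} = (\<lambda>k. {k}) ` {1..5}"
    by (auto simp: card_1_singleton_iff)
  then show ?thesis
    by (simp add: \<beta>_def sum.reindex)
qed

lemma beta_1_eq: "\<beta> 1 = - 3 * \<kappa> - 2 * \<gamma>\<^sub>1"
  using relation unfolding beta_1 by algebra

text \<open>Rows above 6 vanish, so this diagonal has degree at most 4, the degree of the squared
  quadratic. The cofactor is therefore a scalar, which the top coefficient identifies with
  \<open>c\<close>.\<close>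

lemma t_squares:
  "t 5 3 = - 2 * \<gamma>\<^sub>1 * c" "t 4 2 = (\<gamma>\<^sub>1\<^sup>2 + 2 * \<gamma>\<^sub>2) * c"
  "t 3 1 = - 2 * \<gamma>\<^sub>1 * \<gamma>\<^sub>2 * c" "t 2 0 = \<gamma>\<^sub>2\<^sup>2 * c"
proof -
  have "degree (diag_up 1 2 H) \<le> 4"
    by (rule degree_le) (auto simp: coeff_up_1 t_def row_ge_7)
  moreover have P: "[:\<gamma>\<^sub>2, - \<gamma>\<^sub>1, 1:]\<^sup>2 = [:\<gamma>\<^sub>2\<^sup>2, - 2 * \<gamma>\<^sub>1 * \<gamma>\<^sub>2, \<gamma>\<^sub>1\<^sup>2 + 2 * \<gamma>\<^sub>2, - 2 * \<gamma>\<^sub>1, 1:]"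
    by (simp add: power2_eq_square algebra_simps)
  ultimately obtain u where "diag_up 1 2 H = [:\<gamma>\<^sub>2, - \<gamma>\<^sub>1, 1:]\<^sup>2 * u" "degree u \<le> 0"
    using up_1[of 2] by (auto elim!: dvd_cofactor[where m = 0])
  then obtain a where f: "diag_up 1 2 H = [:\<gamma>\<^sub>2, - \<gamma>\<^sub>1, 1:]\<^sup>2 * [:a:]"
    using degree_le_exp(1) by metis
  have t: "t (i + 2) i = coeff ([:\<gamma>\<^sub>2, - \<gamma>\<^sub>1, 1:]\<^sup>2 * [:a:]) i" for i
    by (simp only: f flip: coeff_up_1)
  have "t 6 4 = a"
    using t[of 4] unfolding P by (simp add: eval_nat_numeral)
  moreover have "t 6 4 = c"
    by (simp add: t_eq outside_support row_6)
  ultimately have "a = c" by simp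
  then show "t 5 3 = - 2 * \<gamma>\<^sub>1 * c" "t 4 2 = (\<gamma>\<^sub>1\<^sup>2 + 2 * \<gamma>\<^sub>2) * c"
    "t 3 1 = - 2 * \<gamma>\<^sub>1 * \<gamma>\<^sub>2 * c" "t 2 0 = \<gamma>\<^sub>2\<^sup>2 * c"
    using t[of 3] t[of 2] t[of 1] t[of 0] unfolding P by (simp_all add: eval_nat_numeral)
qed

text \<open>Degree 5 against a quadratic leaves a cubic cofactor. Its coefficients later carry
  information from rows 6 to 3 down to rows 2 and 1.\<close>

lemma t_linear:
  obtains g\<^sub>0 g\<^sub>1 g\<^sub>2 g\<^sub>3 where "t 6 5 = g\<^sub>3" "t 5 4 = g\<^sub>2 - \<gamma>\<^sub>1 * g\<^sub>3" "t 4 3 = g\<^sub>1 - \<gamma>\<^sub>1 * g\<^sub>2 + \<gamma>\<^sub>2 * g\<^sub>3"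
    "t 3 2 = g\<^sub>0 - \<gamma>\<^sub>1 * g\<^sub>1 + \<gamma>\<^sub>2 * g\<^sub>2" "t 2 1 = \<gamma>\<^sub>2 * g\<^sub>1 - \<gamma>\<^sub>1 * g\<^sub>0" "t 1 0 = \<gamma>\<^sub>2 * g\<^sub>0"
proof -
  have "degree (diag_up 1 1 H) \<le> 5"
    by (rule degree_le) (auto simp: coeff_up_1 t_def row_ge_7)
  then obtain u where "diag_up 1 1 H = [:\<gamma>\<^sub>2, - \<gamma>\<^sub>1, 1:] * u" "degree u \<le> 3"
    using up_1[of 1] by (auto elim!: dvd_cofactor[where m = 3])
  then obtain g\<^sub>0 g\<^sub>1 g\<^sub>2 g\<^sub>3 where f: "diag_up 1 1 H = [:\<gamma>\<^sub>2, - \<gamma>\<^sub>1, 1:] * [:g\<^sub>0, g\<^sub>1, g\<^sub>2, g\<^sub>3:]"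
    using degree_le_exp(4) by metis
  have t: "t (i + 1) i = coeff ([:\<gamma>\<^sub>2, - \<gamma>\<^sub>1, 1:] * [:g\<^sub>0, g\<^sub>1, g\<^sub>2, g\<^sub>3:]) i" for i
    by (simp only: f flip: coeff_up_1)
  show thesis
    by (rule that[of g\<^sub>3 g\<^sub>2 g\<^sub>1 g\<^sub>0])
      (use t[of 5] t[of 4] t[of 3] t[of 2] t[of 1] t[of 0] in \<open>simp_all add: eval_nat_numeral\<close>)
qed

text \<open>The cubed quadratic already has the maximal degree 6, so again only the scalar
  \<open>c\<close> is left.\<close>

lemma down_3:
  "h 6 9 = c" "h 5 8 = 3 * \<kappa> * c" "h 4 7 = 3 * (\<kappa>\<^sup>2 + \<epsilon>) * c" "h 3 6 = (\<kappa> ^ 3 + 6 * \<kappa> * \<epsilon>) * c"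
  "h 2 5 = 3 * (\<kappa>\<^sup>2 * \<epsilon> + \<epsilon>\<^sup>2) * c" "h 1 4 = 3 * \<kappa> * \<epsilon>\<^sup>2 * c" "h 0 3 = \<epsilon> ^ 3 * c"
proof -
  have "degree (diag_down 3 H) \<le> 6"
    by (rule degree_le) (auto simp: coeff_diag_down row_ge_7)
  moreover have P: "[:\<epsilon>, \<kappa>, 1:] ^ 3 = [:\<epsilon> ^ 3, 3 * \<kappa> * \<epsilon>\<^sup>2, 3 * (\<kappa>\<^sup>2 * \<epsilon> + \<epsilon>\<^sup>2), \<kappa> ^ 3 + 6 * \<kappa> * \<epsilon>,
      3 * (\<kappa>\<^sup>2 + \<epsilon>), 3 * \<kappa>, 1:]"
    by (simp add: power2_eq_square power3_eq_cube algebra_simps)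
  ultimately obtain u where "diag_down 3 H = [:\<epsilon>, \<kappa>, 1:] ^ 3 * u" "degree u \<le> 0"
    using down[of 3] by (auto elim!: dvd_cofactor[where m = 0])
  then obtain a where f: "diag_down 3 H = [:\<epsilon>, \<kappa>, 1:] ^ 3 * [:a:]"
    using degree_le_exp(1) by metis
  have t: "h i (i + 3) = coeff ([:\<epsilon>, \<kappa>, 1:] ^ 3 * [:a:]) i" for i
    by (simp only: f flip: coeff_diag_down)
  have "a = c"
    using t[of 6] unfolding P by (simp add: eval_nat_numeral c_def)
  then show "h 6 9 = c" "h 5 8 = 3 * \<kappa> * c" "h 4 7 = 3 * (\<kappa>\<^sup>2 + \<epsilon>) * c"
    "h 3 6 = (\<kappa> ^ 3 + 6 * \<kappa> * \<epsilon>) * c" "h 2 5 = 3 * (\<kappa>\<^sup>2 * \<epsilon> + \<epsilon>\<^sup>2) * c"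
    "h 1 4 = 3 * \<kappa> * \<epsilon>\<^sup>2 * c" "h 0 3 = \<epsilon> ^ 3 * c"
    using t[of 6] t[of 5] t[of 4] t[of 3] t[of 2] t[of 1] t[of 0] unfolding P
    by (simp_all add: eval_nat_numeral algebra_simps)
qed

text \<open>The cofactor is now quadratic. Its coefficients appear from the top down as the rows
  descend from 6 to 4, and then fix this weight in all lower rows.\<close>

lemma down_2:
  obtains u\<^sub>0 u\<^sub>1 u\<^sub>2 where "h 6 8 = u\<^sub>2" "h 5 7 = u\<^sub>1 + 2 * \<kappa> * u\<^sub>2"
    "h 4 6 = u\<^sub>0 + 2 * \<kappa> * u\<^sub>1 + (\<kappa>\<^sup>2 + 2 * \<epsilon>) * u\<^sub>2"
    "h 3 5 = 2 * \<kappa> * u\<^sub>0 + (\<kappa>\<^sup>2 + 2 * \<epsilon>) * u\<^sub>1 + 2 * \<kappa> * \<epsilon> * u\<^sub>2"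
    "h 2 4 = (\<kappa>\<^sup>2 + 2 * \<epsilon>) * u\<^sub>0 + 2 * \<kappa> * \<epsilon> * u\<^sub>1 + \<epsilon>\<^sup>2 * u\<^sub>2"
    "h 1 3 = 2 * \<kappa> * \<epsilon> * u\<^sub>0 + \<epsilon>\<^sup>2 * u\<^sub>1" "h 0 2 = \<epsilon>\<^sup>2 * u\<^sub>0"
proof -
  have "degree (diag_down 2 H) \<le> 6"
    by (rule degree_le) (auto simp: coeff_diag_down row_ge_7)
  moreover have P: "[:\<epsilon>, \<kappa>, 1:]\<^sup>2 = [:\<epsilon>\<^sup>2, 2 * \<kappa> * \<epsilon>, \<kappa>\<^sup>2 + 2 * \<epsilon>, 2 * \<kappa>, 1:]"
    by (simp add: power2_eq_square algebra_simps)
  ultimately obtain u where "diag_down 2 H = [:\<epsilon>, \<kappa>, 1:]\<^sup>2 * u" "degree u \<le> 2"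
    using down[of 2] by (auto elim!: dvd_cofactor[where m = 2])
  then obtain u\<^sub>0 u\<^sub>1 u\<^sub>2 where f: "diag_down 2 H = [:\<epsilon>, \<kappa>, 1:]\<^sup>2 * [:u\<^sub>0, u\<^sub>1, u\<^sub>2:]"
    using degree_le_exp(3) by metis
  have t: "h i (i + 2) = coeff ([:\<epsilon>, \<kappa>, 1:]\<^sup>2 * [:u\<^sub>0, u\<^sub>1, u\<^sub>2:]) i" for i
    by (simp only: f flip: coeff_diag_down)
  show thesis
    by (rule that[of u\<^sub>2 u\<^sub>1 u\<^sub>0])
      (use t[of 6] t[of 5] t[of 4] t[of 3] t[of 2] t[of 1] t[of 0] in
        \<open>unfold P, simp_all add: eval_nat_numeral algebra_simps\<close>)
qed

lemma down_1:
  obtains v\<^sub>0 v\<^sub>1 v\<^sub>2 v\<^sub>3 v\<^sub>4 where "h 6 7 = v\<^sub>4" "h 5 6 = v\<^sub>3 + \<kappa> * v\<^sub>4"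
    "h 4 5 = v\<^sub>2 + \<kappa> * v\<^sub>3 + \<epsilon> * v\<^sub>4" "h 3 4 = v\<^sub>1 + \<kappa> * v\<^sub>2 + \<epsilon> * v\<^sub>3" "h 2 3 = v\<^sub>0 + \<kappa> * v\<^sub>1 + \<epsilon> * v\<^sub>2"
    "h 1 2 = \<kappa> * v\<^sub>0 + \<epsilon> * v\<^sub>1" "h 0 1 = \<epsilon> * v\<^sub>0"
proof -
  have "degree (diag_down 1 H) \<le> 6"
    by (rule degree_le) (auto simp: coeff_diag_down row_ge_7)
  then obtain u where "diag_down 1 H = [:\<epsilon>, \<kappa>, 1:] * u" "degree u \<le> 4"
    using down[of 1] by (auto elim!: dvd_cofactor[where m = 4])
  then obtain v\<^sub>0 v\<^sub>1 v\<^sub>2 v\<^sub>3 v\<^sub>4 where f: "diag_down 1 H = [:\<epsilon>, \<kappa>, 1:] * [:v\<^sub>0, v\<^sub>1, v\<^sub>2, v\<^sub>3, v\<^sub>4:]"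
    using degree_le_exp(5) by metis
  have t: "h i (i + 1) = coeff ([:\<epsilon>, \<kappa>, 1:] * [:v\<^sub>0, v\<^sub>1, v\<^sub>2, v\<^sub>3, v\<^sub>4:]) i" for i
    by (simp only: f flip: coeff_diag_down)
  show thesis
    by (rule that[of v\<^sub>4 v\<^sub>3 v\<^sub>2 v\<^sub>1 v\<^sub>0])
      (use t[of 6] t[of 5] t[of 4] t[of 3] t[of 2] t[of 1] t[of 0] in \<open>simp_all add: eval_nat_numeral algebra_simps\<close>)
qed

text \<open>The relation between the parameters enters here: it rewrites \<open>t 5 3\<close> as
  \<open>(\<beta> 1 + 3 * \<kappa>) * c\<close>, so that the coefficient of q^4 p^5 agrees with
  Vieta's formula for all five \<open>r k\<close>.\<close>

lemma row_5:
  "h 5 4 = - \<beta> 1 * c" "h 5 5 = 3 * \<beta> 1 * c - 3 * \<kappa> * c" "h 5 6 = 9 * \<kappa> * c - 3 * \<beta> 1 * c"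
  "h 5 7 = \<beta> 1 * c - 9 * \<kappa> * c" "h 5 8 = 3 * \<kappa> * c"
proof -
  show h58: "h 5 8 = 3 * \<kappa> * c" by (rule down_3)
  have "t 5 3 = \<beta> 1 * c + 3 * \<kappa> * c"
    unfolding t_squares beta_1_eq by (simp add: algebra_simps)
  then have "h 5 4 + h 5 5 + h 5 6 + h 5 7 + h 5 8 = 0"
    "4 * h 5 4 + 5 * h 5 5 + 6 * h 5 6 + 7 * h 5 7 + 8 * h 5 8 = 0"
    "6 * h 5 4 + 10 * h 5 5 + 15 * h 5 6 + 21 * h 5 7 + 28 * h 5 8 = 0"
    "4 * h 5 4 + 10 * h 5 5 + 20 * h 5 6 + 35 * h 5 7 + 56 * h 5 8 = \<beta> 1 * c + 3 * \<kappa> * c"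
    using t_eq_0[of 0 5] t_eq_0[of 1 5] t_eq_0[of 2 5] unfolding t_eq
    by (simp_all add: outside_support)
  from binomial_system[OF this]
  show "h 5 4 = - \<beta> 1 * c" "h 5 5 = 3 * \<beta> 1 * c - 3 * \<kappa> * c"
    "h 5 6 = 9 * \<kappa> * c - 3 * \<beta> 1 * c" "h 5 7 = \<beta> 1 * c - 9 * \<kappa> * c"
    by (simp_all add: h58)
qed

text \<open>
  Only four of the \<open>r k\<close> are known to be distinct; the fifth linear factor of the polynomial
  \<open>diag_up 0 1 H\<close> of degree 5 is determined by its two leading coefficients.
\<close>

lemma up_0_1: "diag_up 0 1 H = smult c (\<Prod>k=1..5. [:- r k, 1:])"
proof -
  obtain k where k: "k \<in> {1..5}" "inj_on r ({1..5} - {k})"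
    by (rule four_distinct)
  define P where "P = (\<Prod>l\<in>{1..5} - {k}. [:- r l, 1:])"
  have P4: "degree P = 4"
    unfolding P_def degree_linear_factors using k by (simp add: card_Diff_singleton)
  have P1: "coeff P 4 = 1"
    using P4 lead_coeff_prod[of "\<lambda>l. [:- r l, 1:]" "{1..5} - {k}"] by (simp add: P_def)
  have full: "(\<Prod>k=1..5. [:- r k, 1:]) = [:- r k, 1:] * P"
    unfolding P_def using k by (intro prod.remove) auto
  have "degree (diag_up 0 1 H) \<le> 5"
    by (rule degree_le) (auto simp: coeff_diag_up row_ge_7)
  moreover have "P dvd diag_up 0 1 H"
    using linear_factors_up_0[OF _ k, of 1] by (simp add: P_def)
  moreover have "P \<noteq> 0" using P4 by auto
  ultimately obtain u where "diag_up 0 1 H = P * u" "degree u \<le> 1"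
    using P4 by (elim dvd_cofactor[where m = 1]) auto
  then obtain a b where f: "diag_up 0 1 H = P * [:a, b:]"
    using degree_le_exp(2) by metis
  have P5: "coeff P 5 = 0" using P4 by (simp add: coeff_eq_0)
  have "coeff (diag_up 0 1 H) 5 = b"
    unfolding f using P5 P1 by (simp add: eval_nat_numeral)
  then have b: "b = c" by (simp add: coeff_diag_up row_6)
  have "coeff (\<Prod>k=1..5. [:- r k, 1:]) 4 = - \<beta> 1"
    using coeff_linear_prod[of "{1..5::nat}" 1 r] by (simp add: \<beta>_def)
  then have "- r k + coeff P 3 = - \<beta> 1"
    unfolding full using P1 by (simp add: eval_nat_numeral)
  moreover have "coeff (diag_up 0 1 H) 4 = a + c * coeff P 3"
    unfolding f using P1 b by (simp add: eval_nat_numeral)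
  then have "a + c * coeff P 3 = - \<beta> 1 * c"
    by (simp add: coeff_diag_up row_5)
  ultimately have "a = - c * r k" by algebra
  then have "[:a, b:] = smult c [:- r k, 1:]"
    by (simp add: b)
  then show ?thesis
    unfolding f full by (simp only: mult_smult_right mult.commute)
qed

lemma up_0_1_coeffs: "h 4 3 = \<beta> 2 * c" "h 3 2 = - \<beta> 3 * c" "h 2 1 = \<beta> 4 * c" "h 1 0 = - \<beta> 5 * c"
proof -
  have "h j i = c * coeff (\<Prod>k=1..5. [:- r k, 1:]) i" if "j = i + 1" for i j
    using that arg_cong[OF up_0_1, of "\<lambda>u. coeff u i"] by (simp add: coeff_diag_up)
  from this[of 4 3] this[of 3 2] this[of 2 1] this[of 1 0]
  show "h 4 3 = \<beta> 2 * c" "h 3 2 = - \<beta> 3 * c" "h 2 1 = \<beta> 4 * c" "h 1 0 = - \<beta> 5 * c"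
    using coeff_linear_prod[of "{1..5::nat}" 2 r] coeff_linear_prod[of "{1..5::nat}" 3 r]
      coeff_linear_prod[of "{1..5::nat}" 4 r] coeff_linear_prod[of "{1..5::nat}" 5 r]
    by (simp_all add: \<beta>_def)
qed

end

section \<open>Solving the system from the top row down\<close>

context degree_15_candidate
begin

text \<open>The constants of I are fixed by their defining equations, so that each is substituted
  only where an identity needs it. Later they become the images in C(t) of the complex
  constants.\<close>

context
  fixes v m b\<^sub>0 A\<^sub>3 x k\<^sub>0 A\<^sub>2 B\<^sub>2 C\<^sub>2 c\<^sub>2 c\<^sub>1 c\<^sub>0 B\<^sub>1 C\<^sub>1 G\<^sub>1 :: 'k
  assumes v: "v = \<gamma>\<^sub>1^2 + 2 * \<gamma>\<^sub>2 - \<beta> 2"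
    and m: "m = v - 3 * (\<kappa>^2 + \<epsilon>)"
    and b\<^sub>0: "b\<^sub>0 = v + 4 * \<kappa> * \<gamma>\<^sub>1 + 3 * \<kappa>^2 - \<epsilon>"
    and A\<^sub>3: "A\<^sub>3 = \<kappa>^3 + 6 * \<kappa> * \<epsilon>"
    and x: "x = 2 * \<kappa> * v + 3 * \<kappa>^3 - 12 * \<kappa> * \<epsilon> + 6 * \<kappa>^2 * \<gamma>\<^sub>1 - 4 * \<epsilon> * \<gamma>\<^sub>1"
    and k\<^sub>0: "k\<^sub>0 = \<gamma>\<^sub>1^3 + 5 * \<kappa> * \<gamma>\<^sub>1^2 + \<kappa> * \<gamma>\<^sub>2 + 9 * \<kappa>^2 * \<gamma>\<^sub>1 - \<epsilon> * \<gamma>\<^sub>1 + 5 * \<kappa>^3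
      - (\<gamma>\<^sub>1 + 2 * \<kappa>) * \<beta> 2 - \<beta> 3"
    and A\<^sub>2: "A\<^sub>2 = 3 * \<kappa>^2 * \<epsilon> + 3 * \<epsilon>^2"
    and B\<^sub>2: "B\<^sub>2 = (\<kappa>^2 + 2 * \<epsilon>) * v + 4 * \<kappa>^3 * \<gamma>\<^sub>1 + 4 * \<kappa> * \<epsilon> * \<gamma>\<^sub>1 + 3 * \<kappa>^4
      - 3 * \<kappa>^2 * \<epsilon> - 6 * \<epsilon>^2"
    and C\<^sub>2: "C\<^sub>2 = \<beta> 4 - 3 * A\<^sub>2 - 2 * B\<^sub>2
      + \<gamma>\<^sub>2 * (\<gamma>\<^sub>1^2 + \<gamma>\<^sub>2 + 3 * \<kappa> * \<gamma>\<^sub>1 + 3 * \<kappa>^2 + 3 * \<epsilon> - \<beta> 2) - \<gamma>\<^sub>1 * k\<^sub>0"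
    and c\<^sub>2: "c\<^sub>2 = - 2 * \<gamma>\<^sub>1^2 - 4 * \<gamma>\<^sub>2 + 3 * \<beta> 2 - 3 * \<kappa>^2 + 3 * \<epsilon> - 6 * \<kappa> * \<gamma>\<^sub>1"
    and c\<^sub>1: "c\<^sub>1 = - 2 * \<gamma>\<^sub>1 * \<gamma>\<^sub>2 - 4 * \<kappa>^3 + 3 * \<kappa> * \<epsilon> - 2 * \<kappa> * \<gamma>\<^sub>1^2 - 4 * \<kappa> * \<gamma>\<^sub>2
      + \<kappa> * \<beta> 2 - 6 * \<kappa>^2 * \<gamma>\<^sub>1 + 2 * \<epsilon> * \<gamma>\<^sub>1 - \<beta> 3"
    and c\<^sub>0: "c\<^sub>0 = C\<^sub>2 - \<kappa> * c\<^sub>1 - \<epsilon> * c\<^sub>2"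
    and B\<^sub>1: "B\<^sub>1 = 2 * \<kappa> * \<epsilon> * b\<^sub>0 - 2 * \<epsilon>^2 * (2 * \<kappa> + \<gamma>\<^sub>1)"
    and C\<^sub>1: "C\<^sub>1 = \<kappa> * c\<^sub>0 + \<epsilon> * c\<^sub>1"
    and G\<^sub>1: "G\<^sub>1 = \<gamma>\<^sub>2 * k\<^sub>0 + \<beta> 5 - 3 * \<kappa> * \<epsilon>^2 - B\<^sub>1 - C\<^sub>1"
begin

text \<open>Rows 4 to 1 are solved inward: the lowest coefficient comes from weight 1, the highest
  from weight -3, and the inner ones from cofactors already known and from conditions at q = 1. A
  solved row in turn releases the next cofactor coefficients.\<close>

lemma lower_coeffs:
  "h 4 4 = (m - 2 * \<beta> 2) * c" "h 4 5 = (3 * (\<kappa>\<^sup>2 + \<epsilon>) - 2 * m + \<beta> 2) * c"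
  "h 4 6 = (m - 6 * (\<kappa>\<^sup>2 + \<epsilon>)) * c"
  "h 3 3 = (A\<^sub>3 + x + 2 * \<beta> 3 + 2 * \<gamma>\<^sub>1 * \<gamma>\<^sub>2) * c" "h 3 4 = - (A\<^sub>3 + 2 * x + \<beta> 3 + 2 * \<gamma>\<^sub>1 * \<gamma>\<^sub>2) * c"
  "h 3 5 = (x - A\<^sub>3) * c"
  "h 2 2 = (\<gamma>\<^sub>2\<^sup>2 - A\<^sub>2 - B\<^sub>2 - C\<^sub>2 - \<beta> 4) * c" "h 2 3 = C\<^sub>2 * c" "h 2 4 = B\<^sub>2 * c"
  "h 1 1 = G\<^sub>1 * c" "h 1 2 = C\<^sub>1 * c" "h 1 3 = B\<^sub>1 * c"
  "h 0 1 = \<epsilon> * c\<^sub>0 * c" "h 0 2 = \<epsilon>\<^sup>2 * b\<^sub>0 * c"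
proof -
  obtain u\<^sub>0 u\<^sub>1 u\<^sub>2 where u: "h 6 8 = u\<^sub>2" "h 5 7 = u\<^sub>1 + 2 * \<kappa> * u\<^sub>2"
    "h 4 6 = u\<^sub>0 + 2 * \<kappa> * u\<^sub>1 + (\<kappa>\<^sup>2 + 2 * \<epsilon>) * u\<^sub>2"
    "h 3 5 = 2 * \<kappa> * u\<^sub>0 + (\<kappa>\<^sup>2 + 2 * \<epsilon>) * u\<^sub>1 + 2 * \<kappa> * \<epsilon> * u\<^sub>2"
    "h 2 4 = (\<kappa>\<^sup>2 + 2 * \<epsilon>) * u\<^sub>0 + 2 * \<kappa> * \<epsilon> * u\<^sub>1 + \<epsilon>\<^sup>2 * u\<^sub>2"
    "h 1 3 = 2 * \<kappa> * \<epsilon> * u\<^sub>0 + \<epsilon>\<^sup>2 * u\<^sub>1" "h 0 2 = \<epsilon>\<^sup>2 * u\<^sub>0"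
    by (rule down_2)
  obtain v\<^sub>0 v\<^sub>1 v\<^sub>2 v\<^sub>3 v\<^sub>4 where v': "h 6 7 = v\<^sub>4" "h 5 6 = v\<^sub>3 + \<kappa> * v\<^sub>4"
    "h 4 5 = v\<^sub>2 + \<kappa> * v\<^sub>3 + \<epsilon> * v\<^sub>4" "h 3 4 = v\<^sub>1 + \<kappa> * v\<^sub>2 + \<epsilon> * v\<^sub>3" "h 2 3 = v\<^sub>0 + \<kappa> * v\<^sub>1 + \<epsilon> * v\<^sub>2"
    "h 1 2 = \<kappa> * v\<^sub>0 + \<epsilon> * v\<^sub>1" "h 0 1 = \<epsilon> * v\<^sub>0"
    by (rule down_1)
  obtain g\<^sub>0 g\<^sub>1 g\<^sub>2 g\<^sub>3 where g: "t 6 5 = g\<^sub>3" "t 5 4 = g\<^sub>2 - \<gamma>\<^sub>1 * g\<^sub>3" "t 4 3 = g\<^sub>1 - \<gamma>\<^sub>1 * g\<^sub>2 + \<gamma>\<^sub>2 * g\<^sub>3"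
    "t 3 2 = g\<^sub>0 - \<gamma>\<^sub>1 * g\<^sub>1 + \<gamma>\<^sub>2 * g\<^sub>2" "t 2 1 = \<gamma>\<^sub>2 * g\<^sub>1 - \<gamma>\<^sub>1 * g\<^sub>0" "t 1 0 = \<gamma>\<^sub>2 * g\<^sub>0"
    by (rule t_linear)
  \<comment> \<open>Rows 6 and 5 fix the two top coefficients of the cofactors in weights -2 and
    -1.\<close>
  have u2: "u\<^sub>2 = - 4 * c" using u(1) row_6 by simp
  have u1: "u\<^sub>1 = - 2 * (2 * \<kappa> + \<gamma>\<^sub>1) * c"
    using u(2) unfolding row_5 u2 beta_1_eq by algebra
  have v4: "v\<^sub>4 = 6 * c" using v'(1) row_6 by simp
  have v3: "v\<^sub>3 = (12 * \<kappa> + 6 * \<gamma>\<^sub>1) * c"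
    using v'(2) unfolding row_5 v4 beta_1_eq by algebra
  \<comment> \<open>Three unknowns remain: the row vanishes to order two at q = 1, and its next
    Taylor coefficient is known.\<close>
  have row_4: "h 4 3 + h 4 4 + h 4 5 + h 4 6 + h 4 7 = 0"
    "3 * h 4 3 + 4 * h 4 4 + 5 * h 4 5 + 6 * h 4 6 + 7 * h 4 7 = 0"
    "3 * h 4 3 + 6 * h 4 4 + 10 * h 4 5 + 15 * h 4 6 + 21 * h 4 7 = (\<gamma>\<^sub>1\<^sup>2 + 2 * \<gamma>\<^sub>2) * c"
    using t_eq_0[of 0 4] t_eq_0[of 1 4] t_squares(2) unfolding t_eq
    by (simp_all add: outside_support)
  have h4: "h 4 3 = \<beta> 2 * c" "h 4 7 = 3 * (\<kappa>\<^sup>2 + \<epsilon>) * c"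
    by (fact up_0_1_coeffs down_3)+
  show h44: "h 4 4 = (m - 2 * \<beta> 2) * c"
    using row_4 unfolding h4 m v by algebra
  show h45: "h 4 5 = (3 * (\<kappa>\<^sup>2 + \<epsilon>) - 2 * m + \<beta> 2) * c"
    using row_4 unfolding h4 m v by algebra
  show h46: "h 4 6 = (m - 6 * (\<kappa>\<^sup>2 + \<epsilon>)) * c"
    using row_4 unfolding h4 m v by algebra
  have u0: "u\<^sub>0 = b\<^sub>0 * c"
    using u(3) unfolding h46 u1 u2 b\<^sub>0 m v by algebra
  have v2: "v\<^sub>2 = c\<^sub>2 * c"
    using v'(3) unfolding h45 v3 v4 c\<^sub>2 m v by algebra
  have h3: "h 3 2 = - \<beta> 3 * c" "h 3 6 = A\<^sub>3 * c"
    unfolding A\<^sub>3 by (fact up_0_1_coeffs down_3)+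
  \<comment> \<open>The cofactor of weight -2 is now complete, which leaves two unknowns in row 3
    for two conditions at q = 1.\<close>
  show h35: "h 3 5 = (x - A\<^sub>3) * c"
    unfolding u u0 u1 u2 x A\<^sub>3 b\<^sub>0 v by algebra
  have row_3: "h 3 2 + h 3 3 + h 3 4 + h 3 5 + h 3 6 = 0"
    "2 * h 3 2 + 3 * h 3 3 + 4 * h 3 4 + 5 * h 3 5 + 6 * h 3 6 = - 2 * \<gamma>\<^sub>1 * \<gamma>\<^sub>2 * c"
    using t_eq_0[of 0 3] t_squares(3) unfolding t_eq
    by (simp_all add: outside_support)
  show h33: "h 3 3 = (A\<^sub>3 + x + 2 * \<beta> 3 + 2 * \<gamma>\<^sub>1 * \<gamma>\<^sub>2) * c"
    using row_3 unfolding h3 h35 by algebra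
  show h34: "h 3 4 = - (A\<^sub>3 + 2 * x + \<beta> 3 + 2 * \<gamma>\<^sub>1 * \<gamma>\<^sub>2) * c"
    using row_3 unfolding h3 h35 by algebra
  have v1: "v\<^sub>1 = c\<^sub>1 * c"
  proof -
    have "v\<^sub>1 = h 3 4 - \<kappa> * v\<^sub>2 - \<epsilon> * v\<^sub>3" using v'(4) by simp
    also have "\<dots> = c\<^sub>1 * c"
      unfolding h34 v2 v3 c\<^sub>1 c\<^sub>2 x A\<^sub>3 v by algebra
    finally show ?thesis .
  qed
  \<comment> \<open>The cubic cofactor at q = 1 is recovered from its top down, one coefficient from
    each of the rows 6 to 3.\<close>
  have g3: "g\<^sub>3 = 5 * c"
    using g(1) unfolding t_eq by (simp add: outside_support row_6)
  have "t 5 4 = h 5 4 + 5 * h 5 5 + 15 * h 5 6 + 35 * h 5 7 + 70 * h 5 8"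
    unfolding t_eq by (simp add: outside_support)
  then have g2: "g\<^sub>2 = (3 * \<kappa> - 3 * \<gamma>\<^sub>1) * c"
    using g(2) unfolding row_5 g3 beta_1_eq by algebra
  have "t 4 3 = h 4 3 + 4 * h 4 4 + 10 * h 4 5 + 20 * h 4 6 + 35 * h 4 7"
    unfolding t_eq by (simp add: outside_support)
  then have "g\<^sub>1 = h 4 3 + 4 * h 4 4 + 10 * h 4 5 + 20 * h 4 6 + 35 * h 4 7 + \<gamma>\<^sub>1 * g\<^sub>2 - \<gamma>\<^sub>2 * g\<^sub>3"
    using g(3) by (simp add: algebra_simps)
  also have "\<dots> = (\<gamma>\<^sub>1\<^sup>2 + 3 * \<gamma>\<^sub>2 + 3 * \<kappa> * \<gamma>\<^sub>1 + 3 * \<kappa>\<^sup>2 + 3 * \<epsilon> - \<beta> 2) * c"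
    unfolding h4 h44 h45 h46 g2 g3 m v by algebra
  finally have g1: "g\<^sub>1 = \<dots>" .
  have "t 3 2 = h 3 2 + 3 * h 3 3 + 6 * h 3 4 + 10 * h 3 5 + 15 * h 3 6"
    unfolding t_eq by (simp add: outside_support)
  then have "g\<^sub>0 = h 3 2 + 3 * h 3 3 + 6 * h 3 4 + 10 * h 3 5 + 15 * h 3 6 + \<gamma>\<^sub>1 * g\<^sub>1 - \<gamma>\<^sub>2 * g\<^sub>2"
    using g(4) by (simp add: algebra_simps)
  also have "\<dots> = k\<^sub>0 * c"
    unfolding h3 h33 h34 h35 g1 g2 k\<^sub>0 x A\<^sub>3 v by algebra
  finally have g0: "g\<^sub>0 = k\<^sub>0 * c" .
  have h2: "h 2 1 = \<beta> 4 * c" "h 2 5 = A\<^sub>2 * c"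
    using up_0_1_coeffs down_3 unfolding A\<^sub>2 by (simp_all add: algebra_simps)
  show h24: "h 2 4 = B\<^sub>2 * c"
    unfolding u u0 u1 u2 B\<^sub>2 b\<^sub>0 v by algebra
  have row_2: "h 2 1 + h 2 2 + h 2 3 + h 2 4 + h 2 5 = \<gamma>\<^sub>2\<^sup>2 * c"
    using t_squares(4) unfolding t_eq by (simp add: outside_support)
  have "t 2 1 = h 2 1 + 2 * h 2 2 + 3 * h 2 3 + 4 * h 2 4 + 5 * h 2 5"
    unfolding t_eq by (simp add: outside_support)
  \<comment> \<open>Eliminating \<open>h 2 2\<close> between the value and the first Taylor
    coefficient at q = 1 isolates \<open>h 2 3\<close>.\<close>
  then have "h 2 3 = \<gamma>\<^sub>2 * g\<^sub>1 - \<gamma>\<^sub>1 * g\<^sub>0 - 2 * \<gamma>\<^sub>2\<^sup>2 * c + h 2 1 - 2 * h 2 4 - 3 * h 2 5"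
    using g(5) row_2 by algebra
  also have "\<dots> = C\<^sub>2 * c"
    unfolding g0 g1 h2 h24 C\<^sub>2 by algebra
  finally show h23: "h 2 3 = C\<^sub>2 * c" .
  show h22: "h 2 2 = (\<gamma>\<^sub>2\<^sup>2 - A\<^sub>2 - B\<^sub>2 - C\<^sub>2 - \<beta> 4) * c"
    using row_2 unfolding h2 h23 h24 by algebra
  have v0: "v\<^sub>0 = c\<^sub>0 * c"
    using v'(5) unfolding h23 v1 v2 c\<^sub>0 by algebra
  show h12: "h 1 2 = C\<^sub>1 * c"
    unfolding v' v0 v1 C\<^sub>1 by algebra
  show h13: "h 1 3 = B\<^sub>1 * c"
    unfolding u u0 u1 B\<^sub>1 by algebra
  have h1: "h 1 0 = - \<beta> 5 * c" "h 1 4 = 3 * \<kappa> * \<epsilon>\<^sup>2 * c"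
    by (fact up_0_1_coeffs down_3)+
  \<comment> \<open>In row 1 only \<open>h 1 1\<close> is still unknown, and the value at q = 1
    determines it.\<close>
  have "h 1 0 + h 1 1 + h 1 2 + h 1 3 + h 1 4 = \<gamma>\<^sub>2 * g\<^sub>0"
    using g(6) unfolding t_eq by (simp add: outside_support)
  then show "h 1 1 = G\<^sub>1 * c"
    unfolding h1 h12 h13 g0 G\<^sub>1 by algebra
  show "h 0 1 = \<epsilon> * c\<^sub>0 * c" "h 0 2 = \<epsilon>\<^sup>2 * b\<^sub>0 * c"
    unfolding u v' u0 v0 by simp_all
qed

text \<open>Both sides are compared row by row in p. The term \<open>h 0 0\<close> is independent of
  q and p and does not affect the Hamiltonian system.\<close>

lemma normal_form:
  defines "C \<equiv> \<lambda>a. [:[:a:]:]" and "q \<equiv> q_var" and "p \<equiv> p_var"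
  shows "H = C c * (q^5 * (q - 1)^4 * p^6
     + q^4 * (q - 1)^3 * (C (3 * \<kappa>) * q + C (\<beta> 1)) * p^5
     + q^3 * (q - 1)^2 * (C (3 * (\<kappa>^2 + \<epsilon>)) * q^2 + C m * q + C (\<beta> 2)) * p^4
     + q^2 * (q - 1) * (C A\<^sub>3 * q^3 + C x * q^2
         - C (A\<^sub>3 + x + \<beta> 3 + 2 * \<gamma>\<^sub>1 * \<gamma>\<^sub>2) * q + C (\<beta> 3)) * p^3
     + q * (C A\<^sub>2 * q^4 + C B\<^sub>2 * q^3 + C C\<^sub>2 * q^2
         + C (\<gamma>\<^sub>2^2 - A\<^sub>2 - B\<^sub>2 - C\<^sub>2 - \<beta> 4) * q + C (\<beta> 4)) * p^2
     + (C (3 * \<kappa> * \<epsilon>^2) * q^4 + C B\<^sub>1 * q^3 + C C\<^sub>1 * q^2 + C G\<^sub>1 * q - C (\<beta> 5)) * p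
     + C (\<epsilon>^3) * q^3 + C (\<epsilon>^2 * b\<^sub>0) * q^2 + C (\<epsilon> * c\<^sub>0) * q) + C (h 0 0)"
proof -
  define X where "X = [:0, 1 :: 'k:]"
  have q: "q = [:X:]"
    by (simp add: q_def X_def q_var_def)
  have p: "[:f:] * p ^ n = monom f n" for f n
    by (simp add: p_def p_var_power smult_monom)
  have p1: "[:f:] * p = monom f 1" for f
    using p[of f 1] by simp
  have row: "coeff H j = [:h j 0, h j 1, h j 2, h j 3, h j 4, h j 5, h j 6, h j 7, h j 8, h j 9:]" for j
    by (rule degree_le_exp(6)[OF degree_row])
  have H: "H = monom (coeff H 6) 6 + monom (coeff H 5) 5 + monom (coeff H 4) 4 + monom (coeff H 3) 3
      + monom (coeff H 2) 2 + monom (coeff H 1) 1 + monom (coeff H 0) 0"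
  proof (rule poly_eqI)
    fix j :: nat
    consider "j = 0" | "j = 1" | "j = 2" | "j = 3" | "j = 4" | "j = 5" | "j = 6" | "j \<ge> 7"
      by linarith
    then show "coeff H j = coeff (monom (coeff H 6) 6 + monom (coeff H 5) 5 + monom (coeff H 4) 4
        + monom (coeff H 3) 3 + monom (coeff H 2) 2 + monom (coeff H 1) 1 + monom (coeff H 0) 0) j"
      by cases (simp_all add: row_ge_7)
  qed
  have leading: "X^5 * (X - 1)^4 = [:0, 0, 0, 0, 0, 1, - 4, 6, - 4, 1:]"
    "X^4 * (X - 1)^3 = [:0, 0, 0, 0, - 1, 3, - 3, 1:]"
    "X^3 * (X - 1)^2 = [:0, 0, 0, 1, - 2, 1:]" "X^2 * (X - 1) = [:0, 0, - 1, 1:]"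
    by (simp_all add: X_def eval_nat_numeral one_pCons)
  have cofactor: "[:a:] * X + [:b:] = [:b, a:]" "[:a:] * X^2 + [:b:] * X + [:d:] = [:d, b, a:]"
    "[:a:] * X^3 + [:b:] * X^2 - [:d:] * X + [:e:] = [:e, - d, b, a:]"
    "X * ([:a:] * X^4 + [:b:] * X^3 + [:d:] * X^2 + [:e:] * X + [:f:]) = [:0, f, e, d, b, a:]"
    "[:a:] * X^4 + [:b:] * X^3 + [:d:] * X^2 + [:e:] * X - [:f:] = [:- f, e, d, b, a:]"
    "[:a:] * X^3 + [:b:] * X^2 + [:d:] * X = [:0, d, b, a:]" for a b d e f
    by (simp_all add: X_def eval_nat_numeral)
  have h36: "h 3 6 = A\<^sub>3 * c" and h25: "h 2 5 = A\<^sub>2 * c"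
    unfolding down_3 A\<^sub>3 A\<^sub>2 by (simp_all add: algebra_simps)
  have rows:
    "coeff H 6 = [:c:] * (X^5 * (X - 1)^4)"
    "coeff H 5 = [:c:] * (X^4 * (X - 1)^3 * ([:3 * \<kappa>:] * X + [:\<beta> 1:]))"
    "coeff H 4 = [:c:] * (X^3 * (X - 1)^2 * ([:3 * (\<kappa>^2 + \<epsilon>):] * X^2 + [:m:] * X + [:\<beta> 2:]))"
    "coeff H 3 = [:c:] * (X^2 * (X - 1) * ([:A\<^sub>3:] * X^3 + [:x:] * X^2
         - [:A\<^sub>3 + x + \<beta> 3 + 2 * \<gamma>\<^sub>1 * \<gamma>\<^sub>2:] * X + [:\<beta> 3:]))"
    "coeff H 2 = [:c:] * (X * ([:A\<^sub>2:] * X^4 + [:B\<^sub>2:] * X^3 + [:C\<^sub>2:] * X^2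
         + [:\<gamma>\<^sub>2^2 - A\<^sub>2 - B\<^sub>2 - C\<^sub>2 - \<beta> 4:] * X + [:\<beta> 4:]))"
    "coeff H 1 = [:c:] * ([:3 * \<kappa> * \<epsilon>^2:] * X^4 + [:B\<^sub>1:] * X^3 + [:C\<^sub>1:] * X^2 + [:G\<^sub>1:] * X - [:\<beta> 5:])"
    "coeff H 0 = [:c:] * ([:\<epsilon>^3:] * X^3 + [:\<epsilon>^2 * b\<^sub>0:] * X^2 + [:\<epsilon> * c\<^sub>0:] * X) + [:h 0 0:]"
    unfolding leading cofactor
    subgoal by (subst row) (simp add: outside_support row_6 algebra_simps)
    subgoal by (subst row) (simp add: outside_support row_5 algebra_simps)
    subgoal by (subst row) (simp add: outside_support up_0_1_coeffs(1) down_3(3) lower_coeffs(1-3) algebra_simps del: One_nat_def)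
    subgoal by (subst row) (simp add: outside_support up_0_1_coeffs(2) h36 lower_coeffs(4-6) algebra_simps del: One_nat_def)
    subgoal by (subst row) (simp add: outside_support up_0_1_coeffs(3) h25 lower_coeffs(7-9) algebra_simps del: One_nat_def)
    subgoal by (subst row) (simp add: outside_support up_0_1_coeffs(4) down_3(6) lower_coeffs(10-12) algebra_simps del: One_nat_def)
    subgoal by (subst row) (simp add: outside_support down_3(7) lower_coeffs(13-14) algebra_simps del: One_nat_def)
    done
  have const: "[:f:] * [:g:] = [:f * g:]" "[:f:] + [:g:] = [:f + g:]" "[:f:] - [:g:] = [:f - g:]"
    "[:f:] - 1 = [:f - 1:]" for f g :: "'k poly"
    by (simp_all add: one_pCons)
  \<comment> \<open>Collects the right-hand side by powers of p; the three summands free of p and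
    \<open>h 0 0\<close> form row 0.\<close>
  have "[:[:c:]:] * (monom f\<^sub>6 6 + monom f\<^sub>5 5 + monom f\<^sub>4 4 + monom f\<^sub>3 3 + monom f\<^sub>2 2 + monom f\<^sub>1 1 + [:a:] + [:b:] + [:d:])
        + [:[:h 0 0:]:]
      = monom ([:c:] * f\<^sub>6) 6 + monom ([:c:] * f\<^sub>5) 5 + monom ([:c:] * f\<^sub>4) 4 + monom ([:c:] * f\<^sub>3) 3
        + monom ([:c:] * f\<^sub>2) 2 + monom ([:c:] * f\<^sub>1) 1 + monom ([:c:] * (a + b + d) + [:h 0 0:]) 0"
    for a b d f\<^sub>1 f\<^sub>2 f\<^sub>3 f\<^sub>4 f\<^sub>5 f\<^sub>6 :: "'k poly"
    by (simp add: smult_add_right smult_monom monom_0)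
  note expand = this
  show ?thesis
    unfolding C_def q const poly_const_pow p p1 expand rows[symmetric] by (rule H)
qed

end

end

section \<open>The total degree and the constants\<close>

text \<open>Needed to bound exponents by the \<open>Max\<close> in the definition of the total
  degree.\<close>

lemma finite_exponents: "finite {i + j |i j. coeff (coeff H j) i \<noteq> 0}"
proof -
  obtain N where N: "degree H \<le> N" "\<And>j. degree (coeff H j) \<le> N"
    using degree_coeff_bound[of H] by blast
  have "{i + j |i j. coeff (coeff H j) i \<noteq> 0} \<subseteq> {..N + N}"
  proof clarsimp
    fix i j
    assume *: "coeff (coeff H j) i \<noteq> 0"
    then have "coeff H j \<noteq> 0" by auto
    then show "i + j \<le> N + N"
      using * N(1) N(2)[of j] le_degree[of H j] le_degree[of "coeff H j" i] by linarith
  qed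
  then show ?thesis by (rule finite_subset) simp
qed

lemma exponent_le_total_degree: "coeff (coeff H j) i \<noteq> 0 \<Longrightarrow> i + j \<le> total_degree H"
  unfolding total_degree_def using finite_exponents[of H] by (intro Max_ge) auto

lemma total_degree_const: "total_degree [:[:a:]:] = 0"
proof -
  have "insert 0 {i + j |i j. coeff (coeff [:[:a:]:] j) i \<noteq> 0} = {0}"
  proof -
    have "i = 0 \<and> j = 0" if "coeff (coeff [:[:a:]:] j) i \<noteq> 0" for i j
      using that by (cases j; cases i) auto
    then show ?thesis by fastforce
  qed
  then show ?thesis by (simp only: total_degree_def Max_singleton)
qed

section \<open>The embedding of C into C(t)\<close>

definition scalar :: "complex \<Rightarrow> Ct" where
  "scalar a = to_fract [:a:]"

lemma scalar_hom:
  "scalar 0 = 0" "scalar 1 = 1" "scalar (a + b) = scalar a + scalar b" "scalar (a - b) = scalar a - scalar b"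
  "scalar (- a) = - scalar a" "scalar (a * b) = scalar a * scalar b"
  by (simp_all add: scalar_def flip: to_fract_add to_fract_diff to_fract_mult to_fract_uminus)
    (simp add: one_pCons flip: to_fract_1)

lemma scalar_power: "scalar (a ^ n) = scalar a ^ n"
  by (induction n) (simp_all add: scalar_hom)

lemma scalar_of_nat: "scalar (of_nat n) = of_nat n"
  by (induction n) (simp_all add: scalar_hom)

lemma scalar_numeral: "scalar (numeral n) = numeral n"
  using scalar_of_nat[of "numeral n"] by simp

lemma scalar_sum: "scalar (sum f A) = (\<Sum>x\<in>A. scalar (f x))"
  by (induction A rule: infinite_finite_induct) (simp_all add: scalar_hom)

lemma scalar_prod: "scalar (prod f A) = (\<Prod>x\<in>A. scalar (f x))"
  by (induction A rule: infinite_finite_induct) (simp_all add: scalar_hom)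

lemmas scalar_simps = scalar_hom scalar_power scalar_numeral

text \<open>Keeps the roots that are distinct in C distinct in C(t).\<close>

lemma inj_scalar: "inj scalar"
  by (auto simp: inj_on_def scalar_def)

lemma const_scalar: "const a = [:[:scalar a:]:]"
  by (simp add: const_def scalar_def)

lemma to_fract_const: "to_fract (const a) = cst (scalar a)"
  by (simp add: const_scalar cst_def)

text \<open>The conditions persist when H is multiplied by a nonzero element of C(t), so the system
  is determined only up to the factor c. The nondegeneracy hypotheses provide the distinct roots for
  the degree counts.\<close>

theorem theorem11p1:
  fixes H :: "Ct poly poly" and \<alpha> :: "nat \<Rightarrow> complex"
  assumes relation: "6 * \<alpha> 0 + 5 * \<alpha> 1 + 4 * \<alpha> 2 + 3 * \<alpha> 3 + 2 * \<alpha> 4 + \<alpha> 5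
      + 4 * \<alpha> 6 + 2 * \<alpha> 7 + 3 * \<alpha> 8 = 0"
    and nondegenerate: "card (rho \<alpha> ` {1..5}) \<ge> 4" "\<alpha> 7 \<noteq> 0"
    and C1: "total_degree H = 15"
    and C2: "\<And>i. i \<le> 7 \<Longrightarrow> becomes_polynomial_hamiltonian H (coords \<alpha> i)"
    and C3: "\<exists>K\<^sub>0. hamiltonian_form H (coords \<alpha> 0) K\<^sub>0 \<and>
      becomes_polynomial_hamiltonian K\<^sub>0 (coords \<alpha> 8)"
  shows "\<exists>c::Ct. c \<noteq> 0 \<and> c = coeff (coeff H 6) 9 \<and>
    dp H = [:[:c:]:] * dp (I_poly \<alpha>) \<and>
    - dq H = [:[:c:]:] * (- dq (I_poly \<alpha>))"
proof -
  have cst_01: "cst 0 = (0 :: Ct poly poly fract)" "cst 1 = (1 :: Ct poly poly fract)"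
    by (simp_all add: cst_def flip: one_pCons)
  \<comment> \<open>The charts with y = 1 / p share one shape, centred at q = 0 or q = 1; r_8 has it
    too, read in the variables of r_0.\<close>
  have chart: "coords \<alpha> k = (- (to_fract p_var * (to_fract q_var - cst s) - cst (scalar a)) * to_fract p_var,
      1 / to_fract p_var)"
    if "(k, s, a) \<in> {(k, 0, rho \<alpha> k) |k. k \<in> {1..5}} \<union> {(6, 1, \<alpha> 6), (7, 1, \<alpha> 6 + \<alpha> 7), (8, 0, \<alpha> 8)}"
    for k s a
    using that by (auto simp: coords_def Let_def to_fract_const cst_01 mult.commute)
  have up_0: "[:- scalar (rho \<alpha> k), 1:] ^ n dvd diag_up 0 n H" if nk: "n > 0" "k \<in> {1..5}" for n k
  proof -
    obtain K where "hamiltonian_form H (coords \<alpha> k) K"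
      using C2[of k] nk unfolding becomes_polynomial_hamiltonian_def by auto
    then show ?thesis
      using nk chart[of k 0 "rho \<alpha> k"] by (intro diag_up_divisible) auto
  qed
  have up_1: "[:scalar (Defs.\<gamma>\<^sub>2 \<alpha>), - scalar (Defs.\<gamma>\<^sub>1 \<alpha>), 1:] ^ n dvd diag_up 1 n H" if n: "n > 0" for n
  proof -
    let ?a = "scalar (\<alpha> 6)" and ?b = "scalar (\<alpha> 6 + \<alpha> 7)"
    obtain K K' where "hamiltonian_form H (coords \<alpha> 6) K" "hamiltonian_form H (coords \<alpha> 7) K'"
      using C2[of 6] C2[of 7] unfolding becomes_polynomial_hamiltonian_def by auto
    then have "[:- ?a, 1:] ^ n dvd diag_up 1 n H" "[:- ?b, 1:] ^ n dvd diag_up 1 n H"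
      using n chart[of 6 1 "\<alpha> 6"] chart[of 7 1 "\<alpha> 6 + \<alpha> 7"] diag_up_divisible by auto
    then have "(\<Prod>a\<in>{?a, ?b}. [:- a, 1:] ^ n) dvd diag_up 1 n H"
      by (intro linear_powers_dvd) auto
    \<comment> \<open>Since \<open>\<alpha> 7\<close> is nonzero, r_6 and r_7 contribute different
      roots, and the product of their powers divides.\<close>
    moreover have "?a \<noteq> ?b"
      using nondegenerate(2) injD[OF inj_scalar, of "\<alpha> 6" "\<alpha> 6 + \<alpha> 7"] by auto
    moreover have "[:- ?a, 1:] * [:- ?b, 1:] = [:scalar (Defs.\<gamma>\<^sub>2 \<alpha>), - scalar (Defs.\<gamma>\<^sub>1 \<alpha>), 1:]"
      by (simp add: Defs.\<gamma>\<^sub>1_def Defs.\<gamma>\<^sub>2_def scalar_simps algebra_simps)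
    ultimately show ?thesis
      by (simp flip: power_mult_distrib)
  qed
  have down: "[:scalar (Defs.\<epsilon> \<alpha>), scalar (Defs.\<kappa> \<alpha>), 1:] ^ n dvd diag_down n H" if n: "n > 0" for n
  proof -
    obtain K\<^sub>0 K where "hamiltonian_form H (coords \<alpha> 0) K\<^sub>0" "hamiltonian_form K\<^sub>0 (coords \<alpha> 8) K"
      using C3 unfolding becomes_polynomial_hamiltonian_def by blast
    then have "[:scalar (\<alpha> 0) * (scalar (\<alpha> 0) + scalar (\<alpha> 8)), 2 * scalar (\<alpha> 0) + scalar (\<alpha> 8), 1:] ^ n
        dvd diag_down n H"
      using n by (intro diag_down_divisible[of H "scalar (\<alpha> 0)" K\<^sub>0 "scalar (\<alpha> 8)" K])
        (simp_all add: chart[of 8 0 "\<alpha> 8"] coords_def[of \<alpha> 0] Let_def to_fract_const)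
    then show ?thesis
      by (simp add: Defs.\<epsilon>_def Defs.\<kappa>_def scalar_simps)
  qed
  have "(\<lambda>k. scalar (rho \<alpha> k)) ` {1..5} = scalar ` rho \<alpha> ` {1..5}"
    by (simp add: image_image)
  then have card: "card ((\<lambda>k. scalar (rho \<alpha> k)) ` {1..5}) \<ge> 4"
    using nondegenerate(1) inj_scalar by (metis card_image inj_on_subset subset_UNIV)
  \<comment> \<open>The sum of the rho_k is 5 \<alpha>_1 + 4 \<alpha>_2 + 3 \<alpha>_3 + 2
    \<alpha>_4 + \<alpha>_5.\<close>
  have "3 * Defs.\<kappa> \<alpha> + 2 * Defs.\<gamma>\<^sub>1 \<alpha> + (\<Sum>k=1..5. rho \<alpha> k) = 0"
    using relation by (simp add: Defs.\<kappa>_def Defs.\<gamma>\<^sub>1_def rho_def eval_nat_numeral algebra_simps)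
  from arg_cong[OF this, of scalar]
  have rel: "3 * scalar (Defs.\<kappa> \<alpha>) + 2 * scalar (Defs.\<gamma>\<^sub>1 \<alpha>) + (\<Sum>k=1..5. scalar (rho \<alpha> k)) = 0"
    by (simp only: scalar_simps scalar_sum)
  interpret cand: degree_15_candidate H "\<lambda>k. scalar (rho \<alpha> k)" "scalar (Defs.\<kappa> \<alpha>)" "scalar (Defs.\<epsilon> \<alpha>)"
    "scalar (Defs.\<gamma>\<^sub>1 \<alpha>)" "scalar (Defs.\<gamma>\<^sub>2 \<alpha>)"
    using exponent_le_total_degree[of H] C1 up_0 card up_1 down rel by unfold_locales auto
  have \<beta>: "cand.\<beta> j = scalar (Defs.\<beta> \<alpha> j)" for j
    by (simp add: cand.\<beta>_def Defs.\<beta>_def scalar_sum scalar_prod)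
  let ?c = "cand.c" and ?h = "coeff (coeff H 0) 0"
  \<comment> \<open>The premises of \<open>cand.normal_form\<close> are the definitions of the
    constants, transported along the ring homomorphism \<open>scalar\<close>.\<close>
  have H: "H = [:[:?c:]:] * I_poly \<alpha> + [:[:?h:]:]"
    unfolding I_poly_def Let_def const_scalar scalar_simps \<beta>[symmetric]
    by (rule cand.normal_form)
      (simp_all only: \<beta> scalar_simps Defs.v_def Defs.m_def Defs.b\<^sub>0_def Defs.A\<^sub>3_def Defs.x_def Defs.k\<^sub>0_def
        Defs.A\<^sub>2_def Defs.B\<^sub>2_def Defs.C\<^sub>2_def Defs.c\<^sub>2_def Defs.c\<^sub>1_def Defs.c\<^sub>0_def Defs.B\<^sub>1_def
        Defs.C\<^sub>1_def Defs.G\<^sub>1_def)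
  \<comment> \<open>With c = 0 the polynomial H would be constant in q and p, which total degree 15
    excludes.\<close>
  have "?c \<noteq> 0"
  proof
    assume "?c = 0"
    then have "total_degree H = 0"
      using H total_degree_const[of ?h] by simp
    with C1 show False by simp
  qed
  moreover have "?c = coeff (coeff H 6) 9"
    by (rule cand.c_def)
  moreover have "dp H = [:[:?c:]:] * dp (I_poly \<alpha>)"
    by (subst H) (simp add: dp.add dp_mult del: mult_pCons_left)
  moreover have "dq H = [:[:?c:]:] * dq (I_poly \<alpha>)"
    by (subst H) (simp add: dq_add dq_mult del: mult_pCons_left)
  ultimately show ?thesis by (intro exI[of _ ?c]) simp
qed

end
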